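(* Let $\varphi:\mathbb{R}^n\to\mathbb{R}$ be abs-smooth with evaluation procedure $(f,c)$ having $s$ switching variables, let $\mathring{x}\in\mathbb{R}^n$, $\mathring{\sigma}=\operatorname{sign}(z[\mathring{x}])$ and $\mathring{\alpha}=\{i\mid\mathring{\sigma}_i=0\}$. For any $\xi\in\operatorname{conv}(\mathcal{D}(\mathring{\sigma}))$ it holds $$\sum_{\sigma\in\mathcal{D}(\mathring{\sigma})}\beta_{\sigma,\xi}\,\nabla\varphi_\sigma(\mathring{x})=\nabla\varphi_\xi(\mathring{x})\quad\text{with}\quad\beta_{\sigma,\xi}:=\prod_{i\in\mathring{\alpha}}\frac{\sigma_i\xi_i+1}{2}.$$ In particular, this is a convex combination (i.e. $\beta_{\sigma,\xi}\ge0$ and $\sum_{\sigma\in\mathcal{D}(\mathring{\sigma})}\beta_{\sigma,\xi}=1$), and thus, if $(f,c)$ satisfies the linear independence kink qualification (LIKQ) at $\mathring{x}$, then $\nabla\varphi_\xi(\mathring{x})\in\partial_C\varphi(\mathring{x})$.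
   Context: Evaluation procedures. Let $n,s\in\mathbb{N}$, $f\in C^2(\mathbb{R}^n\times\mathbb{R}^s\times\mathbb{R}^s;\mathbb{R})$ and $c\in C^2(\mathbb{R}^n\times\mathbb{R}^s\times\mathbb{R}^s;\mathbb{R}^s)$, with $\partial_1,\partial_2,\partial_3$ denoting the partial derivatives with respect to the first, second and third (vector) argument, such that for any pair $(x,z)\in\mathbb{R}^n\times\mathbb{R}^s$ the matrices $\partial_2 c(x,|z|,z)$ and $\partial_3 c(x,|z|,z)$ in $\mathbb{R}^{s\times s}$ are strictly lower triangular (componentwise absolute value). Then for every $x$ the switching equation $z=c(x,|z|,z)$ has a unique solution, denoted $z[x]\in\mathbb{R}^s$. If $\varphi(x)=f(x,|z[x]|,z[x])$ for all $x\in\mathbb{R}^n$, then $(f,c)$ is called an evaluation procedure of $\varphi$ (with $s$ switching variables), and $\varphi$ is called abs-smooth. Signatures. $\operatorname{sign}$ acts componentwise with values in $\{-1,0,1\}$. For $\sigma,\mathring{\sigma}\in\{-1,0,1\}^s$, $\sigma\succeq\mathring{\sigma}$ means $\sigma_i\mathring{\sigma}_i\ge\mathring{\sigma}_i^2$ for all $i$, i.e. $\sigma_i=\mathring{\sigma}_i$ whenever $\mathring{\sigma}_i\neq0$. $\mathcal{D}(\mathring{\sigma})=\{\sigma\in\{-1,1\}^s\mid\sigma\succeq\mathring{\sigma}\}$, and $\operatorname{conv}$ is the convex hull in $\mathbb{R}^s$. Smooth models. For $\xi\in\operatorname{conv}(\mathcal{D}(\mathring{\sigma}))$ (in particular for $\xi=\sigma\in\mathcal{D}(\mathring{\sigma})$)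 and $\Xi=\operatorname{diag}(\xi)$, one has $\Xi z[\mathring{x}]=|z[\mathring{x}]|$. Let $z_\xi[\cdot]$ be the solution operator of the modified switching equation $z_\xi=c(x,\Xi z_\xi,z_\xi)$, with $z_\xi[\mathring{x}]=z[\mathring{x}]$, and set $\varphi_\xi(x)=f(x,\Xi z_\xi[x],z_\xi[x])$, so that $\varphi_\xi(\mathring{x})=\varphi(\mathring{x})$. Only $\nabla\varphi_\xi(\mathring{x})$ is used, so it suffices to consider $z_\xi[\cdot]$ near $\mathring{x}$, where it is a $C^2$ function by the implicit function theorem. LIKQ. For fixed $\mathring{x}$, let $\mathring{z}=z[\mathring{x}]$, $\mathring{\sigma}=\operatorname{sign}(\mathring{z})$, $\mathring{\Sigma}=\operatorname{diag}(\mathring{\sigma})$, $\mathring{\alpha}=\{i\mid\mathring{\sigma}_i=0\}$, let $P_{\mathring{\alpha}}\in\mathbb{R}^{|\mathring{\alpha}|\times s}$ be the matrix with rows $e_i^T$, $i\in\mathring{\alpha}$ ($e_i$ the $i$-th unit vector of $\mathbb{R}^s$), and let $Z=\partial_1 c\in\mathbb{R}^{s\times n}$, $L=\partial_2 c$, $M=\partial_3 c\in\mathbb{R}^{s\times s}$ be the Jacobians of $c$ at $(\mathring{x},|\mathring{z}|,\mathring{z})$. The procedure $(f,c)$ satisfies LIKQ at $\mathring{x}$ if $P_{\mathring{\alpha}}(I_s-L\mathring{\Sigma}-M)^{-1}Z$ has full row rank $|\mathring{\alpha}|$. Generalized gradients. For locally Lipschitz $\varphi$, $\partial_L\varphi(\mathring{x})$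 is the set of all $g=\lim_k\nabla\varphi(x_k)$ where $x_k\to\mathring{x}$ and $\varphi$ is differentiable at every $x_k$; the set of Clarke generalized gradients is $\partial_C\varphi(\mathring{x})=\operatorname{conv}\partial_L\varphi(\mathring{x})$. *)

theory Defs
  imports "HOL-Analysis.Analysis"
begin

text \<open>Index types \<open>'s::{finite,linorder}\<close> carry the linear order needed for triangularity of
  matrices. On \<open>real^'s\<close>, \<open>\<bar>z\<bar>\<close> is the library's componentwise absolute value.\<close>

definition C2 :: "('a::euclidean_space \<Rightarrow> 'b::euclidean_space) \<Rightarrow> bool" where
  "C2 f \<longleftrightarrow> (\<exists>(f' :: 'a \<Rightarrow> 'a \<Rightarrow>\<^sub>L 'b) (f'' :: 'a \<Rightarrow> 'a \<Rightarrow>\<^sub>L ('a \<Rightarrow>\<^sub>L 'b)).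
      (\<forall>x. (f has_derivative blinfun_apply (f' x)) (at x)) \<and>
      (\<forall>x. (f' has_derivative blinfun_apply (f'' x)) (at x)) \<and>
      continuous_on UNIV f'')"

definition jac1 ::
  "((real^'n) \<times> (real^'s) \<times> (real^'s) \<Rightarrow> real^'m) \<Rightarrow> (real^'n) \<times> (real^'s) \<times> (real^'s) \<Rightarrow> real^'n^'m" where
  "jac1 c p = (case p of (x, w, z) \<Rightarrow> jacobian (\<lambda>x'. c (x', w, z)) (at x))"

definition jac2 ::
  "((real^'n) \<times> (real^'s) \<times> (real^'s) \<Rightarrow> real^'m) \<Rightarrow> (real^'n) \<times> (real^'s) \<times> (real^'s) \<Rightarrow> real^'s^'m" where
  "jac2 c p = (case p of (x, w, z) \<Rightarrow> jacobian (\<lambda>w'. c (x, w', z)) (at w))"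

definition jac3 ::
  "((real^'n) \<times> (real^'s) \<times> (real^'s) \<Rightarrow> real^'m) \<Rightarrow> (real^'n) \<times> (real^'s) \<times> (real^'s) \<Rightarrow> real^'s^'m" where
  "jac3 c p = (case p of (x, w, z) \<Rightarrow> jacobian (\<lambda>z'. c (x, w, z')) (at z))"

definition strictly_lower_triangular :: "real^('s::{finite,linorder})^('s::{finite,linorder}) \<Rightarrow> bool" where
  "strictly_lower_triangular A \<longleftrightarrow> (\<forall>i j. i \<le> j \<longrightarrow> A $ i $ j = 0)"

definition switching_sol ::
  "((real^'n) \<times> (real^'s) \<times> (real^'s) \<Rightarrow> real^'s) \<Rightarrow> real^'n \<Rightarrow> real^'s" where
  "switching_sol c x = (THE z. z = c (x, \<bar>z\<bar>, z))"

definition evaluation_procedure ::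
  "((real^'n) \<times> (real^'s::{finite,linorder}) \<times> (real^'s::{finite,linorder}) \<Rightarrow> real) \<Rightarrow>
   ((real^'n) \<times> (real^'s::{finite,linorder}) \<times> (real^'s::{finite,linorder}) \<Rightarrow> real^'s::{finite,linorder}) \<Rightarrow>
   (real^'n \<Rightarrow> real) \<Rightarrow> bool" where
  "evaluation_procedure f c \<phi> \<longleftrightarrow>
     C2 f \<and> C2 c \<and>
     (\<forall>x z. strictly_lower_triangular (jac2 c (x, \<bar>z\<bar>, z)) \<and>
            strictly_lower_triangular (jac3 c (x, \<bar>z\<bar>, z))) \<and>
     (\<forall>x. \<phi> x = f (x, \<bar>switching_sol c x\<bar>, switching_sol c x))"

text \<open>The overloaded constant \<open>sgn\<close> on \<open>real^'s\<close> normalises a vector, so the componentwise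
  sign needs its own definition.\<close>

definition sign_vec :: "real^'s \<Rightarrow> real^'s" where
  "sign_vec z = (\<chi> i. sgn (z $ i))"

definition sig_succeq :: "real^'s \<Rightarrow> real^'s \<Rightarrow> bool"  (infix \<open>\<succeq>\<close> 50) where
  "\<sigma> \<succeq> \<sigma>' \<longleftrightarrow> (\<forall>i. \<sigma> $ i * \<sigma>' $ i \<ge> (\<sigma>' $ i)\<^sup>2)"

definition definite_sigs :: "real^'s \<Rightarrow> (real^'s) set" where
  "definite_sigs \<sigma>' = {\<sigma>. (\<forall>i. \<sigma> $ i \<in> {-1, 1}) \<and> \<sigma> \<succeq> \<sigma>'}"

definition diag :: "real^'s \<Rightarrow> real^'s^'s" where
  "diag v = (\<chi> i j. if i = j then v $ i else 0)"

text \<open>The modified equation \<open>\<zeta> = c(x, \<Xi> \<zeta>, \<zeta>)\<close> need not be uniquely solvable away from \<open>x0\<close>,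
  so a branch through the given value at \<open>x0\<close> is taken on a neighbourhood of \<open>x0\<close>. By the
  implicit function theorem a continuous branch exists, its germ at \<open>x0\<close> is unique, and it is
  \<open>C\<^sup>2\<close> near \<open>x0\<close>; hence the gradient at \<open>x0\<close> does not depend on the choice below.\<close>

definition model_branch ::
  "((real^'n) \<times> (real^'s) \<times> (real^'s) \<Rightarrow> real^'s) \<Rightarrow> real^'n \<Rightarrow> real^'s \<Rightarrow> (real^'n \<Rightarrow> real^'s) \<Rightarrow> bool" where
  "model_branch c x0 \<xi> \<zeta> \<longleftrightarrow>
     \<zeta> x0 = switching_sol c x0 \<and>
     (\<exists>U. open U \<and> x0 \<in> U \<and> continuous_on U \<zeta> \<and>
          (\<forall>x\<in>U. \<zeta> x = c (x, diag \<xi> *v \<zeta> x, \<zeta> x)))"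

definition model_sol ::
  "((real^'n) \<times> (real^'s) \<times> (real^'s) \<Rightarrow> real^'s) \<Rightarrow> real^'n \<Rightarrow> real^'s \<Rightarrow> real^'n \<Rightarrow> real^'s" where
  "model_sol c x0 \<xi> = (SOME \<zeta>. model_branch c x0 \<xi> \<zeta>)"

definition smooth_model ::
  "((real^'n) \<times> (real^'s) \<times> (real^'s) \<Rightarrow> real) \<Rightarrow> ((real^'n) \<times> (real^'s) \<times> (real^'s) \<Rightarrow> real^'s) \<Rightarrow>
   real^'n \<Rightarrow> real^'s \<Rightarrow> real^'n \<Rightarrow> real" where
  "smooth_model f c x0 \<xi> x = f (x, diag \<xi> *v model_sol c x0 \<xi> x, model_sol c x0 \<xi> x)"

definition gradient :: "('a::real_inner \<Rightarrow> real) \<Rightarrow> 'a \<Rightarrow> 'a" where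
  "gradient f x = (THE g. GDERIV f x :> g)"

text \<open>\<open>row_selector \<alpha>\<close> is the matrix with rows \<open>e\<^sub>i\<^sup>T\<close> for \<open>i \<in> \<alpha>\<close>, padded with zero rows to a
  square matrix, because the number of rows \<open>card \<alpha>\<close> is not a type. The padding does not change
  the rank of a product with this matrix as left factor.\<close>

definition row_selector :: "'s set \<Rightarrow> real^'s^'s" where
  "row_selector \<alpha> = (\<chi> i. if i \<in> \<alpha> then axis i 1 else 0)"

definition LIKQ ::
  "((real^'n) \<times> (real^'s) \<times> (real^'s) \<Rightarrow> real^'s) \<Rightarrow> real^'n \<Rightarrow> bool" where
  "LIKQ c x0 \<longleftrightarrow>
     (let z0 = switching_sol c x0; \<sigma>0 = sign_vec z0; \<alpha> = {i. \<sigma>0 $ i = 0};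
          Z = jac1 c (x0, \<bar>z0\<bar>, z0); L = jac2 c (x0, \<bar>z0\<bar>, z0); M = jac3 c (x0, \<bar>z0\<bar>, z0)
      in rank (row_selector \<alpha> ** matrix_inv (mat 1 - L ** diag \<sigma>0 - M) ** Z) = card \<alpha>)"

definition limiting_gradients :: "('a::euclidean_space \<Rightarrow> real) \<Rightarrow> 'a \<Rightarrow> 'a set" where
  "limiting_gradients \<phi> x0 =
     {g. \<exists>X. X \<longlonglongrightarrow> x0 \<and> (\<forall>k::nat. \<phi> differentiable (at (X k))) \<and>
             (\<lambda>k. gradient \<phi> (X k)) \<longlonglongrightarrow> g}"

definition clarke_gradients :: "('a::euclidean_space \<Rightarrow> real) \<Rightarrow> 'a \<Rightarrow> 'a set" where
  "clarke_gradients \<phi> x0 = convex hull (limiting_gradients \<phi> x0)"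

end

theory Submission
  imports Defs
begin

text \<open>The derivative \<open>u\<close> of a branch in direction \<open>v\<close> solves the strictly lower triangular
  system \<open>u = Z v + L \<Xi> u + M u\<close>. Component \<open>i\<close> of \<open>u\<close> depends on \<open>\<xi> $ j\<close> for \<open>j < i\<close> only, hence
  \<open>u\<close> and \<open>\<Xi> u\<close> are affine in every coordinate of \<open>\<xi>\<close>. So is the gradient of the smooth model,
  and a multi-affine function on a cube is the \<open>\<beta>\<close>-weighted mean of its values at the vertices.
  Under LIKQ, every definite signature \<open>\<sigma>\<close> is attained along a ray: there is a direction in which
  the vanishing components of \<open>z_\<sigma>\<close> move to the sides prescribed by \<open>\<sigma>\<close>. Near the points of that
  ray \<open>\<phi>\<close> coincides with \<open>\<phi>_\<sigma>\<close>, so \<open>\<nabla>\<phi>_\<sigma>(x0)\<close> is a limiting gradient.\<close>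

section \<open>Triangular systems and multi-affine interpolation\<close>

text \<open>Stated for arbitrary maps, without derivatives, so that it covers both the linear
  systems below and the nonsmooth switching map.\<close>

definition triangular_map :: "(real^'s::{finite,linorder} \<Rightarrow> real^'s::{finite,linorder}) \<Rightarrow> bool" where
  "triangular_map h \<longleftrightarrow> (\<forall>i y y'. (\<forall>j<i. y $ j = y' $ j) \<longrightarrow> h y $ i = h y' $ i)"

text \<open>Each application of \<open>h\<close> settles further components: once all predecessors
  of \<open>i\<close> have become independent of the starting point, so does component
  \<open>i\<close> one iteration later.\<close>

lemma triangular_map_funpow_eq:
  assumes "triangular_map h" "card {j. j < i} < k"
  shows "(h ^^ k) y $ i = (h ^^ k) y' $ i"
  using assms(2)
proof (induction k arbitrary: i)
  case (Suc k)
  have "(h ^^ k) y $ j = (h ^^ k) y' $ j" if "j < i" for j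
  proof -
    have "{l. l < j} \<subset> {l. l < i}" using that by auto
    then have "card {l. l < j} < card {l. l < i}" by (simp add: psubset_card_mono)
    then show ?thesis using Suc by auto
  qed
  then show ?case using assms(1) by (simp add: triangular_map_def)
qed simp

lemma triangular_map_fixpoint_ex1:
  assumes "triangular_map (h :: real^'s::{finite,linorder} \<Rightarrow> _)"
  shows "\<exists>!z. z = h z"
proof -
  \<comment> \<open>Any number exceeding every predecessor count works; then \<open>h ^^ k\<close>
    is constant. Its value is a fixed point because \<open>h\<close> commutes with its iterates, and
    every fixed point equals this value.\<close>
  define k where "k = Suc CARD('s)"
  have const: "(h ^^ k) y = (h ^^ k) y'" for y y'
  proof -
    have "card {j. j < i} < k" for i :: 's
      unfolding k_def by (metis card_mono finite_class.finite_UNIV le_imp_less_Suc subset_UNIV)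
    then show ?thesis
      by (simp add: vec_eq_iff triangular_map_funpow_eq[OF assms])
  qed
  show ?thesis
  proof (rule ex1I[of _ "(h ^^ k) 0"])
    show "(h ^^ k) 0 = h ((h ^^ k) 0)"
      using const[of 0 "h 0"] by (metis comp_apply funpow.simps(2) funpow_swap1)
    fix z assume z: "z = h z"
    have "(h ^^ n) z = z" for n by (induction n) (simp_all add: z[symmetric])
    then show "z = (h ^^ k) 0" using const by metis
  qed
qed

section \<open>Linear triangular systems\<close>

lemma diag_mult_vec_nth [simp]: "(diag v *v y) $ i = v $ i * y $ i"
proof -
  have "(\<Sum>j\<in>UNIV. (if i = j then v $ i else 0) * y $ j) = (\<Sum>j\<in>UNIV. if i = j then v $ i * y $ j else 0)"
    by (rule sum.cong) auto
  then show ?thesis by (simp add: diag_def matrix_vector_mult_def)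
qed

lemma strictly_lower_triangular_mult_cong:
  assumes "strictly_lower_triangular A" "\<And>j. j < i \<Longrightarrow> y $ j = y' $ j"
  shows "(A *v y) $ i = (A *v y') $ i"
  unfolding matrix_vector_mult_def vec_lambda_beta
proof (rule sum.cong[OF refl])
  fix j show "A $ i $ j * y $ j = A $ i $ j * y' $ j"
    using assms by (cases "j < i") (auto simp: strictly_lower_triangular_def not_less)
qed

text \<open>The number of predecessors strictly decreases along \<open><\<close>, so it serves as
  induction measure.\<close>

lemma finite_linorder_less_induct:
  fixes i :: "'a::{finite,linorder}"
  assumes "\<And>i. (\<And>j. j < i \<Longrightarrow> P j) \<Longrightarrow> P i"
  shows "P i"
proof (induction "card {j. j < i}" arbitrary: i rule: less_induct)
  case less
  show ?case
  proof (rule assms)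
    fix j assume "j < i"
    then have "{l. l < j} \<subset> {l. l < i}" by auto
    then show "P j" by (intro less) (simp add: psubset_card_mono)
  qed
qed

text \<open>This is \<open>(I - L \<Xi> - M)\<close> inverted and applied to \<open>b\<close>,
  written as a fixed point so that components can be computed by forward substitution.\<close>

definition tri_solve ::
  "real^('s::{finite,linorder})^('s::{finite,linorder}) \<Rightarrow> real^('s::{finite,linorder})^('s::{finite,linorder}) \<Rightarrow>
   real^('s::{finite,linorder}) \<Rightarrow> real^('s::{finite,linorder}) \<Rightarrow> real^('s::{finite,linorder})" where
  "tri_solve L M \<xi> b = (THE u. u = b + L *v (diag \<xi> *v u) + M *v u)"

lemma tri_solve_ex1:
  fixes b :: "real^'s::{finite,linorder}"
  assumes "strictly_lower_triangular L" "strictly_lower_triangular M"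
  shows "\<exists>!u. u = b + L *v (diag \<xi> *v u) + M *v u"
proof (rule triangular_map_fixpoint_ex1)
  show "triangular_map (\<lambda>u. b + L *v (diag \<xi> *v u) + M *v u)"
    unfolding triangular_map_def
  proof (intro allI impI)
    fix i and y y' :: "real^'s::{finite,linorder}" assume *: "\<forall>j<i. y $ j = y' $ j"
    have "(L *v (diag \<xi> *v y)) $ i = (L *v (diag \<xi> *v y')) $ i"
      by (rule strictly_lower_triangular_mult_cong) (use assms * in auto)
    moreover have "(M *v y) $ i = (M *v y') $ i"
      by (rule strictly_lower_triangular_mult_cong) (use assms * in auto)
    ultimately show "(b + L *v (diag \<xi> *v y) + M *v y) $ i = (b + L *v (diag \<xi> *v y') + M *v y') $ i"
      by simp
  qed
qed

lemma tri_solve_eq: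
  assumes "strictly_lower_triangular L" "strictly_lower_triangular M"
  shows "tri_solve L M \<xi> b = b + L *v (diag \<xi> *v tri_solve L M \<xi> b) + M *v tri_solve L M \<xi> b"
  using theI'[OF tri_solve_ex1[OF assms]] by (auto simp: tri_solve_def)

lemma tri_solve_unique:
  assumes "strictly_lower_triangular L" "strictly_lower_triangular M"
    and "u = b + L *v (diag \<xi> *v u) + M *v u"
  shows "u = tri_solve L M \<xi> b"
  using tri_solve_ex1[OF assms(1,2)] tri_solve_eq[OF assms(1,2)] assms(3) by blast

text \<open>Forward substitution: component \<open>i\<close> is a polynomial in the data and the
  earlier components, so convergence passes from the predecessors of \<open>i\<close> to
  \<open>i\<close>.\<close>

lemma tri_solve_tendsto:
  fixes L :: "nat \<Rightarrow> real^('s::{finite,linorder})^('s::{finite,linorder})"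
  assumes "\<And>k. strictly_lower_triangular (L k)" "\<And>k. strictly_lower_triangular (M k)"
    and "strictly_lower_triangular L0" "strictly_lower_triangular M0"
    and lim: "L \<longlonglongrightarrow> L0" "M \<longlonglongrightarrow> M0" "b \<longlonglongrightarrow> b0"
  shows "(\<lambda>k. tri_solve (L k) (M k) \<xi> (b k)) \<longlonglongrightarrow> tri_solve L0 M0 \<xi> b0"
proof -
  define u where "u k = tri_solve (L k) (M k) \<xi> (b k)" for k
  define u0 where "u0 = tri_solve L0 M0 \<xi> b0"
  have u: "u k $ i = b k $ i + (\<Sum>j\<in>UNIV. L k $ i $ j * (\<xi> $ j * u k $ j)) + (\<Sum>j\<in>UNIV. M k $ i $ j * u k $ j)" for k i
    using arg_cong[where f="\<lambda>v. v $ i", OF tri_solve_eq[of "L k" "M k" \<xi> "b k"]] assms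
    by (simp add: u_def matrix_vector_mult_def[of "L k"] matrix_vector_mult_def[of "M k"])
  have u0: "u0 $ i = b0 $ i + (\<Sum>j\<in>UNIV. L0 $ i $ j * (\<xi> $ j * u0 $ j)) + (\<Sum>j\<in>UNIV. M0 $ i $ j * u0 $ j)" for i
    using arg_cong[where f="\<lambda>v. v $ i", OF tri_solve_eq[of "L0" "M0" \<xi> "b0"]] assms
    by (simp add: u0_def matrix_vector_mult_def[of "L0"] matrix_vector_mult_def[of "M0"])
  have "(\<lambda>k. u k $ i) \<longlonglongrightarrow> u0 $ i" for i
  proof (induction i rule: finite_linorder_less_induct)
    case (1 i)
    have L: "(\<lambda>k. L k $ i $ j * (\<xi> $ j * u k $ j)) \<longlonglongrightarrow> L0 $ i $ j * (\<xi> $ j * u0 $ j)"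
      and M: "(\<lambda>k. M k $ i $ j * u k $ j) \<longlonglongrightarrow> M0 $ i $ j * u0 $ j" for j
    proof -
      \<comment> \<open>For \<open>j < i\<close> the induction hypothesis applies. Otherwise the
        coefficients vanish, and nothing has to be known about \<open>u k $ j\<close>.\<close>
      consider "j < i" | "i \<le> j" by fastforce
      then have "(\<lambda>k. L k $ i $ j * (\<xi> $ j * u k $ j)) \<longlonglongrightarrow> L0 $ i $ j * (\<xi> $ j * u0 $ j) \<and>
          (\<lambda>k. M k $ i $ j * u k $ j) \<longlonglongrightarrow> M0 $ i $ j * u0 $ j"
      proof cases
        case 1
        then show ?thesis by (intro conjI tendsto_mult tendsto_const tendsto_vec_nth lim "1.IH")
      next
        case 2
        then show ?thesis using assms(1-4) by (simp add: strictly_lower_triangular_def)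
      qed
      then show "(\<lambda>k. L k $ i $ j * (\<xi> $ j * u k $ j)) \<longlonglongrightarrow> L0 $ i $ j * (\<xi> $ j * u0 $ j)"
        "(\<lambda>k. M k $ i $ j * u k $ j) \<longlonglongrightarrow> M0 $ i $ j * u0 $ j" by auto
    qed
    show ?case
      by (subst u, subst u0) (intro tendsto_add tendsto_sum tendsto_vec_nth lim L M)
  qed
  then show ?thesis
    unfolding u_def u0_def by (rule vec_tendstoI)
qed

section \<open>Affine dependence on each coordinate and interpolation over cube vertices\<close>

definition set_coord :: "real^'s \<Rightarrow> 's \<Rightarrow> real \<Rightarrow> real^'s" where
  "set_coord \<xi> i t = (\<chi> j. if j = i then t else \<xi> $ j)"

text \<open>Component \<open>i\<close> of the solution does not see \<open>\<xi> $ i\<close>, so each product \<open>\<xi> $ i * u $ i\<close> is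
  affine, rather than quadratic, in \<open>\<xi> $ i\<close>.\<close>

lemma tri_solve_set_coord_nth:
  fixes b :: "real^'s::{finite,linorder}"
  assumes "strictly_lower_triangular L" "strictly_lower_triangular M" "k \<le> i"
  shows "tri_solve L M (set_coord \<xi> i t) b $ k = tri_solve L M \<xi> b $ k"
  using assms(3)
proof (induction k rule: finite_linorder_less_induct)
  case (1 k)
  have "(L *v (diag (set_coord \<xi> i t) *v tri_solve L M (set_coord \<xi> i t) b)) $ k =
        (L *v (diag \<xi> *v tri_solve L M \<xi> b)) $ k"
    by (rule strictly_lower_triangular_mult_cong) (use assms 1 in \<open>auto simp: set_coord_def\<close>)
  moreover have "(M *v tri_solve L M (set_coord \<xi> i t) b) $ k = (M *v tri_solve L M \<xi> b) $ k"
    by (rule strictly_lower_triangular_mult_cong) (use assms 1 in auto)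
  ultimately show ?case
    using arg_cong[where f="\<lambda>v. v $ k", OF tri_solve_eq[OF assms(1,2), of "set_coord \<xi> i t" b]]
      arg_cong[where f="\<lambda>v. v $ k", OF tri_solve_eq[OF assms(1,2), of \<xi> b]]
    by (simp only: vector_add_component)
qed

text \<open>The combination \<open>w\<close> of the two solutions with coordinate \<open>i\<close>
  set to \<open>1\<close> and \<open>-1\<close> solves the system for \<open>\<xi>\<close>, so
  uniqueness identifies it with \<open>u \<xi>\<close>.\<close>

lemma tri_solve_affine_coord:
  fixes b :: "real^'s::{finite,linorder}"
  assumes "strictly_lower_triangular L" "strictly_lower_triangular M"
  defines "u \<equiv> \<lambda>\<xi>. tri_solve L M \<xi> b"
  shows "diag \<xi> *v u \<xi> = ((1 + \<xi> $ i) / 2) *\<^sub>R (diag (set_coord \<xi> i 1) *v u (set_coord \<xi> i 1)) +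
           ((1 - \<xi> $ i) / 2) *\<^sub>R (diag (set_coord \<xi> i (- 1)) *v u (set_coord \<xi> i (- 1)))"
    and "u \<xi> = ((1 + \<xi> $ i) / 2) *\<^sub>R u (set_coord \<xi> i 1) + ((1 - \<xi> $ i) / 2) *\<^sub>R u (set_coord \<xi> i (- 1))"
proof -
  define p q where "p = (1 + \<xi> $ i) / 2" and "q = (1 - \<xi> $ i) / 2"
  define up um where "up = u (set_coord \<xi> i 1)" and "um = u (set_coord \<xi> i (- 1))"
  define dp dm where "dp = diag (set_coord \<xi> i 1) *v up" and "dm = diag (set_coord \<xi> i (- 1)) *v um"
  define w where "w = p *\<^sub>R up + q *\<^sub>R um"
  have pq: "p + q = 1" "p - q = \<xi> $ i" by (auto simp: p_def q_def field_simps)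
  have ui: "up $ i = u \<xi> $ i" "um $ i = u \<xi> $ i"
    unfolding up_def um_def u_def by (simp_all add: tri_solve_set_coord_nth assms(1,2))
  have d: "diag \<xi> *v w = p *\<^sub>R dp + q *\<^sub>R dm"
  proof (simp add: vec_eq_iff, rule)
    fix j show "\<xi> $ j * w $ j = p * dp $ j + q * dm $ j"
    \<comment> \<open>Only coordinate \<open>i\<close> needs an argument: \<open>up\<close> and
      \<open>um\<close> agree there, so the right-hand side is \<open>(p - q) * u \<xi> $ i\<close>,
      and \<open>p - q = \<xi> $ i\<close>.\<close>
    proof (cases "j = i")
      case True
      have "w $ i = (p + q) * u \<xi> $ i" by (simp add: w_def ui algebra_simps)
      then show ?thesis using True
        by (simp add: pq(1) dp_def dm_def set_coord_def ui flip: pq(2)) (simp add: algebra_simps)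
    next
      case False
      then show ?thesis by (simp add: dp_def dm_def set_coord_def w_def algebra_simps)
    qed
  qed
  have up: "up = b + L *v dp + M *v up" and um: "um = b + L *v dm + M *v um"
    unfolding dp_def dm_def up_def um_def u_def by (rule tri_solve_eq[OF assms(1,2)])+
  have "w = p *\<^sub>R (b + L *v dp + M *v up) + q *\<^sub>R (b + L *v dm + M *v um)"
    unfolding w_def by (rule arg_cong2[where f="\<lambda>v v'. p *\<^sub>R v + q *\<^sub>R v'", OF up um])
  also have "\<dots> = (p + q) *\<^sub>R b + L *v (p *\<^sub>R dp + q *\<^sub>R dm) + M *v w"
    by (simp add: w_def matrix_vector_right_distrib matrix_vector_mult_scaleR algebra_simps)
  finally have "w = b + L *v (diag \<xi> *v w) + M *v w" by (simp add: pq d)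
  then have "w = u \<xi>" unfolding u_def by (rule tri_solve_unique[OF assms(1,2)])
  then show "u \<xi> = ((1 + \<xi> $ i) / 2) *\<^sub>R u (set_coord \<xi> i 1) + ((1 - \<xi> $ i) / 2) *\<^sub>R u (set_coord \<xi> i (- 1))"
    and "diag \<xi> *v u \<xi> = ((1 + \<xi> $ i) / 2) *\<^sub>R (diag (set_coord \<xi> i 1) *v u (set_coord \<xi> i 1)) +
           ((1 - \<xi> $ i) / 2) *\<^sub>R (diag (set_coord \<xi> i (- 1)) *v u (set_coord \<xi> i (- 1)))"
    using d by (simp_all add: w_def up_def um_def dp_def dm_def p_def q_def)
qed

text \<open>Coordinates outside \<open>A\<close> stay frozen at those of \<open>\<xi>\<close>, so an
  induction on \<open>A\<close> can release one coordinate at a time.\<close>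

definition cube_vertices :: "'s set \<Rightarrow> real^'s \<Rightarrow> (real^'s) set" where
  "cube_vertices A \<xi> = {\<sigma>. (\<forall>i\<in>A. \<sigma> $ i \<in> {- 1, 1}) \<and> (\<forall>i. i \<notin> A \<longrightarrow> \<sigma> $ i = \<xi> $ i)}"

lemma cube_vertices_empty: "cube_vertices {} \<xi> = {\<xi>}"
  by (auto simp: cube_vertices_def vec_eq_iff)

lemma cube_vertices_insert:
  assumes "i \<notin> A"
  shows "cube_vertices (insert i A) \<xi> = cube_vertices A (set_coord \<xi> i 1) \<union> cube_vertices A (set_coord \<xi> i (- 1))"
  using assms by (auto simp: cube_vertices_def set_coord_def split: if_splits)

lemma finite_cube_vertices: "finite A \<Longrightarrow> finite (cube_vertices A \<xi>)"
proof (induction A arbitrary: \<xi> rule: finite_induct)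
  case empty
  then show ?case by (simp add: cube_vertices_empty)
next
  case (insert i A)
  then show ?case by (simp add: cube_vertices_insert)
qed

text \<open>Split \<open>g\<close> affinely in one coordinate and interpolate both halves over the
  remaining ones. The weights \<open>(1 + \<xi> $ i) / 2\<close> and
  \<open>(1 - \<xi> $ i) / 2\<close> are the factors
  \<open>(\<sigma> $ i * \<xi> $ i + 1) / 2\<close> at \<open>\<sigma> $ i = 1\<close> and
  \<open>\<sigma> $ i = -1\<close>.\<close>

lemma multiaffine_interpolation:
  fixes g :: "real^'s \<Rightarrow> 'v::real_vector"
  assumes "finite A"
    and aff: "\<And>\<xi> i. g \<xi> = ((1 + \<xi> $ i) / 2) *\<^sub>R g (set_coord \<xi> i 1) + ((1 - \<xi> $ i) / 2) *\<^sub>R g (set_coord \<xi> i (- 1))"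
  shows "g \<xi> = (\<Sum>\<sigma>\<in>cube_vertices A \<xi>. (\<Prod>i\<in>A. (\<sigma> $ i * \<xi> $ i + 1) / 2) *\<^sub>R g \<sigma>)"
  using assms(1)
proof (induction A arbitrary: \<xi> rule: finite_induct)
  case empty
  then show ?case by (simp add: cube_vertices_empty)
next
  case (insert i A)
  let ?\<beta> = "\<lambda>A \<sigma> \<xi>. \<Prod>i\<in>A. (\<sigma> $ i * \<xi> $ i + 1 :: real) / 2"
  \<comment> \<open>Here \<open>t\<close> stands for \<open>1\<close> and \<open>-1\<close>, which
    treats both halves at once.\<close>
  have half: "((1 + t * \<xi> $ i) / 2) *\<^sub>R g (set_coord \<xi> i t) =
      (\<Sum>\<sigma>\<in>cube_vertices A (set_coord \<xi> i t). ?\<beta> (insert i A) \<sigma> \<xi> *\<^sub>R g \<sigma>)" for t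
  proof -
    have "?\<beta> (insert i A) \<sigma> \<xi> = (1 + t * \<xi> $ i) / 2 * ?\<beta> A \<sigma> (set_coord \<xi> i t)"
      if "\<sigma> \<in> cube_vertices A (set_coord \<xi> i t)" for \<sigma>
    proof -
      have "\<sigma> $ i = t" using that insert by (simp add: cube_vertices_def set_coord_def)
      moreover have "?\<beta> A \<sigma> (set_coord \<xi> i t) = ?\<beta> A \<sigma> \<xi>"
        by (rule prod.cong) (use insert in \<open>auto simp: set_coord_def\<close>)
      ultimately show ?thesis using insert by (simp add: add.commute)
    qed
    then show ?thesis
      unfolding insert.IH[of "set_coord \<xi> i t"] scaleR_sum_right scaleR_scaleR
      by (intro sum.cong refl) (rule arg_cong2[where f = scaleR], auto)
  qed
  have "cube_vertices A (set_coord \<xi> i 1) \<inter> cube_vertices A (set_coord \<xi> i (- 1)) = {}"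
    using insert by (auto simp: cube_vertices_def set_coord_def)
  then show ?case
    unfolding cube_vertices_insert[OF insert.hyps(2)]
    by (subst sum.union_disjoint)
      (use half[of 1] half[of "- 1"] aff[of \<xi> i] in \<open>simp_all add: finite_cube_vertices insert.hyps(1) del: prod.insert\<close>)
qed

section \<open>Implicit functions and the switching equation\<close>

text \<open>The inverse function theorem is applied to \<open>G (x, y) = (x, F (x, y))\<close>, and
  \<open>\<zeta> x\<close> is the second component of the inverse at \<open>(x, 0)\<close>. The
  neighbourhood \<open>N\<close> records that zeros near \<open>(a, b)\<close> are unique; this
  later transfers differentiability to any continuous branch.\<close>

lemma implicit_function:
  fixes F :: "'a::euclidean_space \<times> 'b::euclidean_space \<Rightarrow> 'b"
    and F' :: "'a \<times> 'b \<Rightarrow> ('a \<times> 'b) \<Rightarrow>\<^sub>L 'b"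
  assumes der: "\<And>p. (F has_derivative blinfun_apply (F' p)) (at p)"
    and cont: "continuous_on UNIV F'"
    and zero: "F (a, b) = 0"
    and inj: "\<And>w. F' (a, b) (0, w) = 0 \<Longrightarrow> w = 0"
  obtains \<zeta> W N where "open W" "a \<in> W" "continuous_on W \<zeta>" "\<And>x. x \<in> W \<Longrightarrow> F (x, \<zeta> x) = 0"
    "\<zeta> a = b" "\<zeta> differentiable (at a)"
    "open N" "(a, b) \<in> N" "\<And>x y. (x, y) \<in> N \<Longrightarrow> F (x, y) = 0 \<Longrightarrow> y = \<zeta> x"
proof -
  define G where "G p = (fst p, F p)" for p
  define G' where "G' p = Blinfun (\<lambda>h. (fst h, F' p h))" for p
  have bl: "bounded_linear (\<lambda>h. (fst h, F' p h))" for p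
    by (intro bounded_linear_intros blinfun.bounded_linear_right)
  have G': "blinfun_apply (G' p) = (\<lambda>h. (fst h, F' p h))" for p
    unfolding G'_def by (rule bounded_linear_Blinfun_apply[OF bl])
  have derG: "(G has_derivative blinfun_apply (G' p)) (at p)" for p
    unfolding G_def G' by (auto intro!: derivative_eq_intros der)
  have contG: "continuous_on UNIV G'"
  proof (rule continuous_on_blinfun_componentwise)
    fix i :: "'a \<times> 'b"
    show "continuous_on UNIV (\<lambda>p. blinfun_apply (G' p) i)"
      unfolding G' by (intro continuous_intros cont)
  qed
  \<comment> \<open>A kernel vector has first component zero, so \<open>inj\<close> disposes of the
    second. Injectivity yields the left inverse \<open>T\<close> for the inverse function
    theorem.\<close>
  have "inj (blinfun_apply (G' (a, b)))"
  proof (rule linear_injective_0[THEN iffD2, rule_format])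
    show "linear (blinfun_apply (G' (a, b)))"
      by (simp add: blinfun.bounded_linear_right bounded_linear.linear)
    fix h assume "blinfun_apply (G' (a, b)) h = 0"
    then have "fst h = 0" "F' (a, b) h = 0" by (auto simp: G' zero_prod_def)
    then show "h = 0" using inj[of "snd h"] by (cases h) (auto simp: zero_prod_def)
  qed
  then obtain T where T: "linear T" "T \<circ> blinfun_apply (G' (a, b)) = id"
    using linear_injective_left_inverse[of "blinfun_apply (G' (a, b))"]
    by (auto simp: blinfun.bounded_linear_right bounded_linear.linear)
  have "Blinfun T o\<^sub>L G' (a, b) = id_blinfun"
  proof (rule blinfun_eqI)
    fix i
    have "blinfun_apply (Blinfun T) = T"
      using T(1) linear_conv_bounded_linear bounded_linear_Blinfun_apply by blast
    then show "blinfun_apply (Blinfun T o\<^sub>L G' (a, b)) i = blinfun_apply id_blinfun i"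
      using T(2) by (metis blinfun_apply_blinfun_compose blinfun_apply_id_blinfun comp_apply id_apply)
  qed
  then obtain U V g g' where UV: "open U" "(a, b) \<in> U" "open V" "G (a, b) \<in> V" "homeomorphism U V G g"
    and derg: "\<And>y. y \<in> V \<Longrightarrow> (g has_derivative (g' y)) (at y)"
    using inverse_function_theorem[OF open_UNIV derG contG UNIV_I] by metis
  define \<zeta> where "\<zeta> x = snd (g (x, 0))" for x
  define W where "W = (\<lambda>x. (x, 0::'b)) -` V"
  have Gab: "G (a, b) = (a, 0)" by (simp add: G_def zero)
  have Gg: "G (g y) = y" if "y \<in> V" for y
    using UV(5) that by (simp add: homeomorphism_apply2)
  have gG: "g (G p) = p" if "p \<in> U" for p
    using UV(5) that by (simp add: homeomorphism_apply1)
  show ?thesis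
  proof (rule that[of W \<zeta> U])
    show "open W" unfolding W_def by (intro open_vimage UV continuous_intros)
    show "a \<in> W" using UV(4) by (simp add: W_def Gab)
    show "continuous_on W \<zeta>"
      unfolding \<zeta>_def
      by (intro continuous_on_snd continuous_on_compose2[OF homeomorphism_cont2[OF UV(5)]] continuous_intros)
        (auto simp: W_def)
    show "F (x, \<zeta> x) = 0" if "x \<in> W" for x
    proof -
      have "(fst (g (x, 0)), F (g (x, 0))) = (x, 0)"
        using Gg[of "(x, 0)"] that by (simp add: W_def G_def)
      then show ?thesis unfolding \<zeta>_def by (metis Pair_inject prod.collapse)
    qed
    show "\<zeta> a = b" using gG[OF UV(2)] by (simp add: \<zeta>_def Gab)
    have "((\<lambda>x. g (x, 0)) has_derivative (\<lambda>h. g' (a, 0) (h, 0))) (at a)"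
      by (rule has_derivative_compose[of _ "\<lambda>h. (h, 0)"])
        (use derg UV(4) in \<open>auto intro!: derivative_eq_intros simp: Gab\<close>)
    then show "\<zeta> differentiable (at a)"
      unfolding \<zeta>_def differentiable_def using has_derivative_snd by blast
    show "y = \<zeta> x" if "(x, y) \<in> U" "F (x, y) = 0" for x y
      using gG[OF that(1)] that(2) by (simp add: G_def \<zeta>_def)
  qed (use UV in auto)
qed

text \<open>Freezing two arguments restricts \<open>D\<close> to one slot, where it is the
  corresponding partial Jacobian; linearity adds the three slots.\<close>

lemma has_derivative_jac:
  fixes c :: "(real^'n) \<times> (real^'s) \<times> (real^'s) \<Rightarrow> real^'m"
  assumes "(c has_derivative D) (at p)"
  shows "D (v, w, y) = jac1 c p *v v + jac2 c p *v w + jac3 c p *v y"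
proof -
  obtain a b d where p: "p = (a, b, d)" by (metis prod.exhaust)
  interpret D: linear D using assms has_derivative_linear by blast
  have "((\<lambda>x. c (x, b, d)) has_derivative (\<lambda>v. D (v, 0, 0))) (at a)"
    using assms unfolding p
    by (rule has_derivative_compose[rotated, where g = c and g' = D]) (intro has_derivative_Pair has_derivative_ident has_derivative_const)
  then have 1: "D (v, 0, 0) = jac1 c p *v v"
    by (simp add: p jac1_def jacobian_def has_derivative_linear flip: frechet_derivative_at)
  have "((\<lambda>x. c (a, x, d)) has_derivative (\<lambda>v. D (0, v, 0))) (at b)"
    using assms unfolding p
    by (rule has_derivative_compose[rotated, where g = c and g' = D]) (intro has_derivative_Pair has_derivative_ident has_derivative_const)
  then have 2: "D (0, w, 0) = jac2 c p *v w"
    by (simp add: p jac2_def jacobian_def has_derivative_linear flip: frechet_derivative_at)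
  have "((\<lambda>x. c (a, b, x)) has_derivative (\<lambda>v. D (0, 0, v))) (at d)"
    using assms unfolding p
    by (rule has_derivative_compose[rotated, where g = c and g' = D]) (intro has_derivative_Pair has_derivative_ident has_derivative_const)
  then have 3: "D (0, 0, y) = jac3 c p *v y"
    by (simp add: p jac3_def jacobian_def has_derivative_linear flip: frechet_derivative_at)
  have "(v, w, y) = (v, 0, 0) + (0, w, 0) + (0, 0, y)" by simp
  then show ?thesis by (simp only: D.add 1 2 3)
qed

text \<open>Riesz representation in an orthonormal basis shows that the description defining
  \<open>gradient\<close> has exactly one witness.\<close>

lemma has_derivative_gradient:
  fixes f :: "'a::euclidean_space \<Rightarrow> real"
  assumes "(f has_derivative D) (at x)"
  shows "gradient f x \<bullet> w = D w"
proof -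
  interpret D: linear D using assms has_derivative_linear by blast
  define g where "g = (\<Sum>b\<in>Basis. D b *\<^sub>R b)"
  have g: "h \<bullet> g = D h" for h
  proof -
    have "D h = D (\<Sum>b\<in>Basis. (h \<bullet> b) *\<^sub>R b)" by (simp add: euclidean_representation)
    also have "\<dots> = h \<bullet> g" by (simp add: D.sum D.scale g_def inner_sum_right mult.commute)
    finally show ?thesis by simp
  qed
  have "GDERIV f x :> g" using assms by (simp add: gderiv_def g)
  moreover have "g' = g" if "GDERIV f x :> g'" for g'
  proof -
    have "(\<lambda>h. h \<bullet> g') = (\<lambda>h. h \<bullet> g)"
      using that \<open>GDERIV f x :> g\<close> has_derivative_unique unfolding gderiv_def by blast
    then show ?thesis by (metis inner_commute vector_eq_ldot)
  qed
  ultimately have "gradient f x = g" unfolding gradient_def by (rule the_equality)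
  then show ?thesis using g[of w] by (simp add: inner_commute)
qed

text \<open>The segment from \<open>y\<close> to \<open>y'\<close> meets the kinks of the absolute value at finitely many parameters
  only: a coordinate that varies vanishes at most once.\<close>

lemma switching_map_triangular:
  fixes c :: "(real^'n) \<times> (real^'s::{finite,linorder}) \<times> (real^'s::{finite,linorder}) \<Rightarrow> real^'s::{finite,linorder}"
  assumes der: "\<And>p. (c has_derivative blinfun_apply (c' p)) (at p)"
    and tri: "\<And>z. strictly_lower_triangular (jac2 c (x, \<bar>z\<bar>, z))"
      "\<And>z. strictly_lower_triangular (jac3 c (x, \<bar>z\<bar>, z))"
  shows "triangular_map (\<lambda>z. c (x, \<bar>z\<bar>, z))"
  unfolding triangular_map_def
proof (intro allI impI)
  fix i and y y' :: "real^'s::{finite,linorder}"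
  assume eq: "\<forall>j<i. y $ j = y' $ j"
  define d where "d = y' - y"
  define \<gamma> where "\<gamma> t = y + t *\<^sub>R d" for t
  define K where "K = (\<Union>j. {t. d $ j \<noteq> 0 \<and> \<gamma> t $ j = 0})"
  have "finite {t. d $ j \<noteq> 0 \<and> \<gamma> t $ j = 0}" for j
  proof (rule finite_subset)
    show "{t. d $ j \<noteq> 0 \<and> \<gamma> t $ j = 0} \<subseteq> {- y $ j / d $ j}"
      by (auto simp: \<gamma>_def field_simps)
  qed simp
  then have "finite K" by (simp add: K_def)
  have cont_c: "continuous_on UNIV c"
    by (simp add: continuous_at_imp_continuous_on has_derivative_continuous[OF der])
  have abs_nth: "\<bar>z\<bar> $ j = \<bar>z $ j\<bar>" for z :: "real^'s::{finite,linorder}" and j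
    by (simp add: abs_vec_def)
  have cont_abs: "continuous_on UNIV (\<lambda>t. \<bar>\<gamma> t\<bar>)"
    unfolding abs_vec_def \<gamma>_def by (intro continuous_intros)
  have cont_\<gamma>: "continuous_on UNIV \<gamma>" unfolding \<gamma>_def by (intro continuous_intros)
  have "continuous_on UNIV (\<lambda>t. (x, \<bar>\<gamma> t\<bar>, \<gamma> t))"
    by (rule continuous_on_Pair[OF continuous_on_const continuous_on_Pair[OF cont_abs cont_\<gamma>]])
  from continuous_on_compose2[OF cont_c this subset_UNIV]
  have cont_seg: "continuous_on UNIV (\<lambda>t. c (x, \<bar>\<gamma> t\<bar>, \<gamma> t) $ i)"
    by (rule continuous_on_component)
  \<comment> \<open>The Jacobians are known to be triangular only at points
    \<open>(x, \<bar>z\<bar>, z)\<close>, so the path runs through such points. Along it component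
    \<open>i\<close> is continuous with zero derivative off the finite set \<open>K\<close>, hence
    constant.\<close>
  have "c (x, \<bar>\<gamma> 1\<bar>, \<gamma> 1) $ i = c (x, \<bar>\<gamma> 0\<bar>, \<gamma> 0) $ i"
  proof (rule has_derivative_zero_unique_strong_interval[OF \<open>finite K\<close>,
        where f = "\<lambda>t. c (x, \<bar>\<gamma> t\<bar>, \<gamma> t) $ i" and a = 0 and b = 1])
    show "continuous_on {0..1} (\<lambda>t. c (x, \<bar>\<gamma> t\<bar>, \<gamma> t) $ i)"
      using cont_seg by (rule continuous_on_subset) simp
    fix t :: real assume "t \<in> {0..1} - K"
    then have nz: "d $ j = 0 \<or> \<gamma> t $ j \<noteq> 0" for j by (auto simp: K_def)
    \<comment> \<open>This is the velocity of \<open>\<bar>\<gamma>\<bar>\<close>. A coordinate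
      resting at a kink has \<open>d $ j = 0\<close> and contributes zero, so the undefined slope of
      the absolute value does not enter.\<close>
    define e where "e = diag (sign_vec (\<gamma> t)) *v d"
    have "((\<lambda>t. \<bar>\<gamma> t $ j\<bar>) has_derivative (\<lambda>h. h * e $ j)) (at t)" for j
    proof (cases "d $ j = 0")
      case True
      then show ?thesis by (simp add: \<gamma>_def e_def)
    next
      case False
      then have "y $ j + t * d $ j \<noteq> 0" using nz[of j] by (simp add: \<gamma>_def)
      have "((\<lambda>t. y $ j + t * d $ j) has_derivative (\<lambda>h. h * d $ j)) (at t)"
        by (auto intro!: derivative_eq_intros)
      from has_derivative_compose[OF this GDERIV_norm[unfolded gderiv_def]] \<open>y $ j + t * d $ j \<noteq> 0\<close>
      show ?thesis by (simp add: \<gamma>_def e_def sign_vec_def mult_ac)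
    qed
    then have "((\<lambda>t. \<bar>\<gamma> t\<bar>) has_derivative (\<lambda>h. h *\<^sub>R e)) (at t)"
      unfolding has_derivative_componentwise_within[of "\<lambda>t. \<bar>\<gamma> t\<bar>"]
      by (simp add: Basis_vec_def abs_nth inner_axis)
    moreover have "(\<gamma> has_derivative (\<lambda>h. h *\<^sub>R d)) (at t)"
      unfolding \<gamma>_def by (auto intro!: derivative_eq_intros)
    ultimately have "((\<lambda>t. (x, \<bar>\<gamma> t\<bar>, \<gamma> t)) has_derivative (\<lambda>h. (0, h *\<^sub>R e, h *\<^sub>R d))) (at t)"
      by (intro has_derivative_Pair has_derivative_const)
    from has_derivative_compose[OF this der]
    have "((\<lambda>t. c (x, \<bar>\<gamma> t\<bar>, \<gamma> t)) has_derivative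
        (\<lambda>h. jac2 c (x, \<bar>\<gamma> t\<bar>, \<gamma> t) *v (h *\<^sub>R e) + jac3 c (x, \<bar>\<gamma> t\<bar>, \<gamma> t) *v (h *\<^sub>R d))) (at t)"
      by (simp add: has_derivative_jac[OF der])
    from bounded_linear.has_derivative[OF bounded_linear_vec_nth[of i] this]
    have "((\<lambda>t. c (x, \<bar>\<gamma> t\<bar>, \<gamma> t) $ i) has_derivative
        (\<lambda>h. (jac2 c (x, \<bar>\<gamma> t\<bar>, \<gamma> t) *v (h *\<^sub>R e)) $ i + (jac3 c (x, \<bar>\<gamma> t\<bar>, \<gamma> t) *v (h *\<^sub>R d)) $ i)) (at t)"
      by simp
    \<comment> \<open>Row \<open>i\<close> of a strictly lower triangular matrix sees only
      coordinates below \<open>i\<close>, where both velocities vanish.\<close>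
    moreover have "d $ j = 0" "e $ j = 0" if "j < i" for j using eq that by (simp_all add: d_def e_def)
    then have "(jac2 c (x, \<bar>\<gamma> t\<bar>, \<gamma> t) *v (h *\<^sub>R e)) $ i = (jac2 c (x, \<bar>\<gamma> t\<bar>, \<gamma> t) *v 0) $ i"
      and "(jac3 c (x, \<bar>\<gamma> t\<bar>, \<gamma> t) *v (h *\<^sub>R d)) $ i = (jac3 c (x, \<bar>\<gamma> t\<bar>, \<gamma> t) *v 0) $ i" for h
      by (intro strictly_lower_triangular_mult_cong[OF tri(1)] strictly_lower_triangular_mult_cong[OF tri(2)]; simp)+
    ultimately show "((\<lambda>t. c (x, \<bar>\<gamma> t\<bar>, \<gamma> t) $ i) has_derivative (\<lambda>h. 0)) (at t within {0..1})"
      by (simp only: matrix_vector_mult_0_right zero_index add_0 has_derivative_at_withinI)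
  qed simp_all
  moreover have "\<gamma> 0 = y" "\<gamma> 1 = y'" by (simp_all add: \<gamma>_def d_def)
  ultimately show "c (x, \<bar>y\<bar>, y) $ i = c (x, \<bar>y'\<bar>, y') $ i" by simp
qed

lemma switching_sol_eq_iff:
  fixes c :: "(real^'n) \<times> (real^'s::{finite,linorder}) \<times> (real^'s::{finite,linorder}) \<Rightarrow> real^'s::{finite,linorder}"
  assumes "\<And>p. (c has_derivative blinfun_apply (c' p)) (at p)"
    and "\<And>z. strictly_lower_triangular (jac2 c (x, \<bar>z\<bar>, z))"
      "\<And>z. strictly_lower_triangular (jac3 c (x, \<bar>z\<bar>, z))"
  shows "z = switching_sol c x \<longleftrightarrow> z = c (x, \<bar>z\<bar>, z)"
proof -
  have "\<exists>!z. z = c (x, \<bar>z\<bar>, z)"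
    by (rule triangular_map_fixpoint_ex1) (rule switching_map_triangular[OF assms])
  then have ex1: "\<exists>!z. z = c (x, \<bar>z\<bar>, z)" .
  have "switching_sol c x = c (x, \<bar>switching_sol c x\<bar>, switching_sol c x)"
    unfolding switching_sol_def by (rule theI'[OF ex1])
  with ex1 show ?thesis by blast
qed

section \<open>Smooth models\<close>

lemma tendsto_matrix_columns:
  fixes A :: "'a \<Rightarrow> real^'n^'m"
  assumes "\<And>j. ((\<lambda>k. A k *v axis j 1) \<longlongrightarrow> A0 *v axis j 1) F"
  shows "(A \<longlongrightarrow> A0) F"
proof (intro vec_tendstoI)
  fix i j
  show "((\<lambda>k. A k $ i $ j) \<longlongrightarrow> A0 $ i $ j) F"
    using tendsto_vec_nth[OF assms[of j], of i] by (simp add: matrix_vector_mult_basis column_def)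
qed

text \<open>The first derivatives are parameters with continuity in operator norm, the form in which
  both the implicit function argument and the passage to limits use them.\<close>

locale C1_switching_system =
  fixes f :: "(real^'n) \<times> (real^'s::{finite,linorder}) \<times> (real^'s::{finite,linorder}) \<Rightarrow> real"
    and c :: "(real^'n) \<times> (real^'s::{finite,linorder}) \<times> (real^'s::{finite,linorder}) \<Rightarrow> real^'s::{finite,linorder}"
    and f' c'
  assumes der_f: "\<And>p. (f has_derivative blinfun_apply (f' p)) (at p)"
    and der_c: "\<And>p. (c has_derivative blinfun_apply (c' p)) (at p)"
    and cont_f': "continuous_on UNIV f'"
    and cont_c': "continuous_on UNIV c'"
    and tri_jac2: "\<And>x z. strictly_lower_triangular (jac2 c (x, \<bar>z\<bar>, z))"
    and tri_jac3: "\<And>x z. strictly_lower_triangular (jac3 c (x, \<bar>z\<bar>, z))"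
begin

lemma switching_sol_iff: "z = switching_sol c x \<longleftrightarrow> z = c (x, \<bar>z\<bar>, z)"
  by (rule switching_sol_eq_iff[OF der_c tri_jac2 tri_jac3])

text \<open>The candidate for the derivative of a branch in direction \<open>v\<close>, confirmed by
  \<open>branch_has_derivative\<close>. The base point \<open>p\<close> is free so that it can vary
  along a sequence.\<close>

definition slope where
  "slope \<xi> p v = tri_solve (jac2 c p) (jac3 c p) \<xi> (jac1 c p *v v)"

definition tangent where
  "tangent \<xi> p v = (v, diag \<xi> *v slope \<xi> p v, slope \<xi> p v)"

text \<open>The implicit function theorem for \<open>y - c (x, \<Xi> y, y)\<close>. Its partial
  derivative in \<open>y\<close> is \<open>I - L \<Xi> - M\<close>, which is injective because the
  homogeneous triangular system has only the zero solution.\<close>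

lemma local_branch:
  assumes p: "p = (a, diag \<xi> *v b, b)" and b: "b = c p"
    and tri: "strictly_lower_triangular (jac2 c p)" "strictly_lower_triangular (jac3 c p)"
  obtains \<zeta> W N where "open W" "a \<in> W" "continuous_on W \<zeta>"
    "\<And>x. x \<in> W \<Longrightarrow> \<zeta> x = c (x, diag \<xi> *v \<zeta> x, \<zeta> x)"
    "\<zeta> a = b" "\<zeta> differentiable (at a)"
    "open N" "(a, b) \<in> N" "\<And>x y. (x, y) \<in> N \<Longrightarrow> y = c (x, diag \<xi> *v y, y) \<Longrightarrow> y = \<zeta> x"
proof -
  \<comment> \<open>Packing the substitution \<open>(x, y)\<close> to \<open>(x, \<Xi> y, y)\<close>
    as a bounded linear map makes \<open>F'\<close> a composition, whence its continuity.\<close>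
  define J :: "((real^'n) \<times> (real^'s::{finite,linorder})) \<Rightarrow>\<^sub>L ((real^'n) \<times> (real^'s::{finite,linorder}) \<times> (real^'s::{finite,linorder}))"
    where "J = Blinfun (\<lambda>h. (fst h, diag \<xi> *v snd h, snd h))"
  have "bounded_linear (\<lambda>h :: (real^'n) \<times> (real^'s::{finite,linorder}). (fst h, diag \<xi> *v snd h, snd h))"
    by (intro bounded_linear_Pair bounded_linear_fst bounded_linear_snd
        bounded_linear_compose[OF matrix_vector_mul_bounded_linear])
  then have J: "blinfun_apply J h = (fst h, diag \<xi> *v snd h, snd h)" for h
    unfolding J_def by (simp add: bounded_linear_Blinfun_apply)
  define F where "F q = snd q - c (J q)" for q
  define F' where "F' q = Blinfun snd - (c' (J q) o\<^sub>L J)" for q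
  have F': "blinfun_apply (F' q) h = snd h - c' (J q) (J h)" for q h
    by (simp add: F'_def blinfun.diff_left bounded_linear_Blinfun_apply bounded_linear_snd)
  have derF: "(F has_derivative blinfun_apply (F' q)) (at q)" for q
  proof -
    have "((\<lambda>q. c (J q)) has_derivative (\<lambda>h. c' (J q) (J h))) (at q)"
      by (rule has_derivative_compose[OF _ der_c])
        (rule bounded_linear_imp_has_derivative[OF blinfun.bounded_linear_right])
    from has_derivative_diff[OF has_derivative_snd[OF has_derivative_ident] this]
    show ?thesis unfolding F_def F'[abs_def] .
  qed
  have contF: "continuous_on UNIV F'"
    unfolding F'_def
    by (intro continuous_intros continuous_on_compose2[OF cont_c']) simp
  have zero: "F (a, b) = 0" using b by (simp add: F_def J p)
  have inj: "w = 0" if "F' (a, b) (0, w) = 0" for w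
  proof -
    have "w = 0 + jac2 c p *v (diag \<xi> *v w) + jac3 c p *v w"
      using that by (simp add: F' J has_derivative_jac[OF der_c] flip: p)
    then have "w = tri_solve (jac2 c p) (jac3 c p) \<xi> 0" by (rule tri_solve_unique[OF tri])
    moreover have "0 = tri_solve (jac2 c p) (jac3 c p) \<xi> 0" by (rule tri_solve_unique[OF tri]) simp
    ultimately show ?thesis by simp
  qed
  have F0: "F (x, y) = 0 \<longleftrightarrow> y = c (x, diag \<xi> *v y, y)" for x y by (simp add: F_def J)
  from implicit_function[OF derF contF zero inj] show ?thesis
    using that unfolding F0 by (smt (verit))
qed

text \<open>Continuity keeps the graph of \<open>\<zeta>\<close> inside \<open>N\<close> near
  \<open>a\<close>, where solutions are unique. So \<open>\<zeta>\<close> coincides there with the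
  differentiable branch, and differentiating its equation gives the triangular system of
  \<open>slope\<close>.\<close>

lemma branch_has_derivative:
  assumes U: "open U" "a \<in> U" "continuous_on U \<zeta>"
    and eq: "\<And>x. x \<in> U \<Longrightarrow> \<zeta> x = c (x, diag \<xi> *v \<zeta> x, \<zeta> x)"
    and p: "p = (a, diag \<xi> *v \<zeta> a, \<zeta> a)"
    and tri: "strictly_lower_triangular (jac2 c p)" "strictly_lower_triangular (jac3 c p)"
  shows "(\<zeta> has_derivative slope \<xi> p) (at a)"
    and "((\<lambda>x. (x, diag \<xi> *v \<zeta> x, \<zeta> x)) has_derivative tangent \<xi> p) (at a)"
proof -
  have "\<zeta> a = c p" using eq[OF U(2)] by (simp only: p)
  then obtain \<eta> N where \<eta>: "\<eta> differentiable (at a)" "open N" "(a, \<zeta> a) \<in> N"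
    "\<And>x y. (x, y) \<in> N \<Longrightarrow> y = c (x, diag \<xi> *v y, y) \<Longrightarrow> y = \<eta> x"
    using local_branch[OF p _ tri] by metis
  have "continuous_on U (\<lambda>x. (x, \<zeta> x))" by (intro continuous_intros U)
  then have "open (U \<inter> (\<lambda>x. (x, \<zeta> x)) -` N)"
    using \<eta>(2) U(1) by (simp add: continuous_on_open_vimage Int_commute)
  then obtain D where D: "(\<zeta> has_derivative D) (at a)"
    using \<eta>(1,3,4) U(2) eq has_derivative_transform_within_open[of \<eta> _ a UNIV "U \<inter> (\<lambda>x. (x, \<zeta> x)) -` N" \<zeta>]
    unfolding differentiable_def by (metis (mono_tags, lifting) IntD1 IntD2 IntI vimageE vimageI)
  then have D2: "((\<lambda>x. (x, diag \<xi> *v \<zeta> x, \<zeta> x)) has_derivative (\<lambda>v. (v, diag \<xi> *v D v, D v))) (at a)"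
    by (intro has_derivative_Pair has_derivative_ident
        bounded_linear.has_derivative[OF matrix_vector_mul_bounded_linear])
  have "((\<lambda>x. c (x, diag \<xi> *v \<zeta> x, \<zeta> x)) has_derivative (\<lambda>v. c' p (v, diag \<xi> *v D v, D v))) (at a)"
    unfolding p by (rule has_derivative_compose[OF D2 der_c])
  then have "(\<zeta> has_derivative (\<lambda>v. c' p (v, diag \<xi> *v D v, D v))) (at a)"
    by (rule has_derivative_transform_within_open[OF _ U(1,2)]) (simp flip: eq)
  then have "D = (\<lambda>v. c' p (v, diag \<xi> *v D v, D v))" using D has_derivative_unique by blast
  then have "D v = jac1 c p *v v + jac2 c p *v (diag \<xi> *v D v) + jac3 c p *v D v" for v
    by (metis has_derivative_jac[OF der_c])
  then have "D v = slope \<xi> p v" for v unfolding slope_def by (rule tri_solve_unique[OF tri])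
  then have "D = slope \<xi> p" by blast
  then show "(\<zeta> has_derivative slope \<xi> p) (at a)"
    and "((\<lambda>x. (x, diag \<xi> *v \<zeta> x, \<zeta> x)) has_derivative tangent \<xi> p) (at a)"
    using D D2 by (simp_all add: tangent_def[abs_def])
qed

text \<open>Since \<open>\<Xi> z = \<bar>z\<bar>\<close> at \<open>x0\<close>, the switching
  solution also solves the modified equation. A branch through it therefore exists, and the choice
  in \<open>model_sol\<close> is meaningful.\<close>

lemma model_branch_model_sol:
  assumes "diag \<xi> *v switching_sol c x0 = \<bar>switching_sol c x0\<bar>"
  shows "model_branch c x0 \<xi> (model_sol c x0 \<xi>)"
proof -
  let ?z = "switching_sol c x0"
  have "?z = c (x0, diag \<xi> *v ?z, ?z)" using switching_sol_iff[of ?z x0] assms by simp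
  then obtain \<zeta> W where "open W" "x0 \<in> W" "continuous_on W \<zeta>"
    "\<And>x. x \<in> W \<Longrightarrow> \<zeta> x = c (x, diag \<xi> *v \<zeta> x, \<zeta> x)" "\<zeta> x0 = ?z"
    using local_branch[OF refl, of ?z x0 \<xi>] tri_jac2[of x0 ?z] tri_jac3[of x0 ?z] assms by metis
  then have "model_branch c x0 \<xi> \<zeta>" unfolding model_branch_def by blast
  then show ?thesis unfolding model_sol_def by (rule someI[where P = "model_branch c x0 \<xi>"])
qed

text \<open>The base point \<open>p\<close> is the same for all admissible \<open>\<xi>\<close>, so
  by the chain rule the gradient depends on \<open>\<xi>\<close> through \<open>tangent\<close>
  alone, and linearly on that.\<close>

lemma inner_gradient_smooth_model:
  assumes "diag \<xi> *v switching_sol c x0 = \<bar>switching_sol c x0\<bar>"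
    and p: "p = (x0, \<bar>switching_sol c x0\<bar>, switching_sol c x0)"
  shows "gradient (smooth_model f c x0 \<xi>) x0 \<bullet> v = f' p (tangent \<xi> p v)"
proof -
  let ?\<zeta> = "model_sol c x0 \<xi>"
  obtain U where U: "open U" "x0 \<in> U" "continuous_on U ?\<zeta>"
      "\<And>x. x \<in> U \<Longrightarrow> ?\<zeta> x = c (x, diag \<xi> *v ?\<zeta> x, ?\<zeta> x)"
    and x0: "?\<zeta> x0 = switching_sol c x0"
    using model_branch_model_sol[OF assms(1)] unfolding model_branch_def by blast
  have p': "p = (x0, diag \<xi> *v ?\<zeta> x0, ?\<zeta> x0)" using assms x0 by simp
  have "(smooth_model f c x0 \<xi> has_derivative (\<lambda>v. f' p (tangent \<xi> p v))) (at x0)"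
    unfolding smooth_model_def[abs_def]
    using has_derivative_compose[OF branch_has_derivative(2)[OF U p'] der_f] tri_jac2 tri_jac3
    by (simp flip: p' add: p)
  then show ?thesis by (rule has_derivative_gradient)
qed

lemma tangent_affine_coord:
  assumes "strictly_lower_triangular (jac2 c p)" "strictly_lower_triangular (jac3 c p)"
  shows "tangent \<xi> p v = ((1 + \<xi> $ i) / 2) *\<^sub>R tangent (set_coord \<xi> i 1) p v +
           ((1 - \<xi> $ i) / 2) *\<^sub>R tangent (set_coord \<xi> i (- 1)) p v"
proof -
  have "v = ((1 + \<xi> $ i) / 2) *\<^sub>R v + ((1 - \<xi> $ i) / 2) *\<^sub>R v"
    by (simp add: field_simps flip: scaleR_add_left)
  then show ?thesis
    unfolding tangent_def slope_def scaleR_Pair add_Pair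
    using tri_solve_affine_coord[OF assms, of \<xi> "jac1 c p *v v" i] by blast
qed

text \<open>Testing the continuous derivative \<open>c'\<close> on vectors supported in one slot
  yields convergence of the three Jacobians, and triangular solutions depend continuously on
  them.\<close>

lemma tangent_tendsto:
  assumes p: "p \<longlonglongrightarrow> p0"
    and "\<And>k. strictly_lower_triangular (jac2 c (p k))" "\<And>k. strictly_lower_triangular (jac3 c (p k))"
    and "strictly_lower_triangular (jac2 c p0)" "strictly_lower_triangular (jac3 c p0)"
  shows "(\<lambda>k. tangent \<xi> (p k) v) \<longlonglongrightarrow> tangent \<xi> p0 v"
proof -
  have c': "(\<lambda>k. c' (p k) h) \<longlonglongrightarrow> c' p0 h" for h
    using continuous_on_tendsto_compose[OF cont_c' p] by (intro blinfun.tendsto) auto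
  have "(\<lambda>k. jac1 c (p k) *v v) \<longlonglongrightarrow> jac1 c p0 *v v"
    using c'[of "(v, 0, 0)"] by (simp add: has_derivative_jac[OF der_c])
  moreover have "(\<lambda>k. jac2 c (p k)) \<longlonglongrightarrow> jac2 c p0"
    using c'[of "(0, axis _ 1, 0)"] by (intro tendsto_matrix_columns) (simp add: has_derivative_jac[OF der_c])
  moreover have "(\<lambda>k. jac3 c (p k)) \<longlonglongrightarrow> jac3 c p0"
    using c'[of "(0, 0, axis _ 1)"] by (intro tendsto_matrix_columns) (simp add: has_derivative_jac[OF der_c])
  ultimately have "(\<lambda>k. slope \<xi> (p k) v) \<longlonglongrightarrow> slope \<xi> p0 v"
    unfolding slope_def using assms by (intro tri_solve_tendsto)
  then show ?thesis
    unfolding tangent_def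
    by (intro tendsto_Pair tendsto_const bounded_linear.tendsto[OF matrix_vector_mul_bounded_linear])
qed

end

section \<open>Signatures and limiting gradients\<close>

lemma diag_mult_eq_abs:
  assumes "\<And>i. \<bar>z $ i\<bar> = \<xi> $ i * z $ i"
  shows "diag \<xi> *v z = \<bar>z\<bar>"
  by (simp add: vec_eq_iff abs_vec_def assms)

lemma row_selector_mult_nth: "(row_selector A *v y) $ i = (if i \<in> A then y $ i else 0)"
  using inner_axis'[of i 1 y]
  by (simp add: row_selector_def matrix_vector_mul_component)

text \<open>The range lies in the coordinate subspace of \<open>\<alpha>\<close>. Full row rank
  makes the dimensions equal, so values on \<open>\<alpha>\<close> can be prescribed freely.\<close>

lemma row_selector_surj:
  fixes A :: "real^'n^'s"
  assumes "rank (row_selector \<alpha> ** A) = card \<alpha>"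
  obtains v where "\<And>i. i \<in> \<alpha> \<Longrightarrow> (A *v v) $ i = y $ i"
proof -
  let ?R = "range (\<lambda>v. (row_selector \<alpha> ** A) *v v)"
  let ?S = "{y :: real^'s. \<forall>i. i \<notin> \<alpha> \<longrightarrow> y $ i = 0}"
  have "dim ?S = card \<alpha>" using dim_substandard_cart[of \<alpha>, where 'a = real] by (simp only: dim_vec_eq)
  then have "dim ?R = dim ?S" using assms by (simp add: rank_dim_range)
  moreover have "?R \<subseteq> ?S"
    by (auto simp: row_selector_mult_nth simp flip: matrix_vector_mul_assoc)
  moreover have "subspace ?R"
    by (intro linear_subspace_image matrix_vector_mul_linear subspace_UNIV)
  moreover have "subspace ?S"
    by (auto simp: subspace_def)
  ultimately have "?R = ?S" by (intro subspace_dim_equal) auto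
  moreover have "row_selector \<alpha> *v y \<in> ?S" by (simp add: row_selector_mult_nth)
  ultimately have "row_selector \<alpha> *v y \<in> ?R" by simp
  then obtain v where "row_selector \<alpha> *v y = row_selector \<alpha> *v (A *v v)"
    by (auto simp flip: matrix_vector_mul_assoc)
  then have "(row_selector \<alpha> *v y) $ i = (row_selector \<alpha> *v (A *v v)) $ i" for i by simp
  then have "(A *v v) $ i = y $ i" if "i \<in> \<alpha>" for i
    using that by (metis row_selector_mult_nth)
  then show ?thesis by (rule that)
qed

text \<open>Where \<open>\<sigma>0 $ i\<close> is \<open>1\<close> or \<open>-1\<close>, the order
  relation forces \<open>\<sigma> $ i = \<sigma>0 $ i\<close>. The reference point
  \<open>\<xi>\<close> is left open: it is used both with \<open>\<sigma>0\<close> itself and with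
  points of the hull.\<close>

lemma definite_sigs_eq_cube_vertices:
  assumes "\<sigma>0 = sign_vec z" "\<And>i. \<sigma>0 $ i \<noteq> 0 \<Longrightarrow> \<xi> $ i = \<sigma>0 $ i"
  shows "definite_sigs \<sigma>0 = cube_vertices {i. \<sigma>0 $ i = 0} \<xi>"
proof -
  have 0: "\<sigma>0 $ i = 0 \<or> \<sigma>0 $ i = 1 \<or> \<sigma>0 $ i = - 1" for i
    by (auto simp: assms(1) sign_vec_def sgn_if)
  have iff: "(\<sigma> $ i \<in> {- 1, 1} \<and> \<sigma> $ i * \<sigma>0 $ i \<ge> (\<sigma>0 $ i)\<^sup>2) \<longleftrightarrow>
      (if \<sigma>0 $ i = 0 then \<sigma> $ i \<in> {- 1, 1} else \<sigma> $ i = \<xi> $ i)" for \<sigma> i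
    using 0[of i] assms(2)[of i] by auto
  have "\<sigma> \<in> definite_sigs \<sigma>0 \<longleftrightarrow> \<sigma> \<in> cube_vertices {i. \<sigma>0 $ i = 0} \<xi>" for \<sigma>
  proof -
    have "\<sigma> \<in> definite_sigs \<sigma>0 \<longleftrightarrow> (\<forall>i. if \<sigma>0 $ i = 0 then \<sigma> $ i \<in> {- 1, 1} else \<sigma> $ i = \<xi> $ i)"
      unfolding definite_sigs_def sig_succeq_def iff[symmetric] by blast
    then show ?thesis unfolding cube_vertices_def by auto
  qed
  then show ?thesis by blast
qed

text \<open>Both properties define a convex set containing all definite signatures. The bound makes
  the weights nonnegative; the agreement with \<open>\<sigma>0\<close> gives
  \<open>\<Xi> z = \<bar>z\<bar>\<close>.\<close>

lemma convex_hull_definite_sigs_bounds: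
  assumes "\<xi> \<in> convex hull (definite_sigs \<sigma>0)" "\<sigma>0 = sign_vec z"
  shows "\<bar>\<xi> $ i\<bar> \<le> 1" "\<sigma>0 $ i \<noteq> 0 \<Longrightarrow> \<xi> $ i = \<sigma>0 $ i"
proof -
  let ?S = "{\<xi>. \<forall>i. \<bar>\<xi> $ i\<bar> \<le> 1 \<and> (\<sigma>0 $ i \<noteq> 0 \<longrightarrow> \<xi> $ i = \<sigma>0 $ i)}"
  have "convex ?S"
  proof (rule convexI, safe)
    fix x y :: "real^'a" and u v :: real and i
    assume x: "\<forall>i. \<bar>x $ i\<bar> \<le> 1 \<and> (\<sigma>0 $ i \<noteq> 0 \<longrightarrow> x $ i = \<sigma>0 $ i)"
      and y: "\<forall>i. \<bar>y $ i\<bar> \<le> 1 \<and> (\<sigma>0 $ i \<noteq> 0 \<longrightarrow> y $ i = \<sigma>0 $ i)"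
      and uv: "0 \<le> u" "0 \<le> v" "u + v = 1"
    have "\<bar>u * x $ i + v * y $ i\<bar> \<le> u * 1 + v * 1"
      using x y uv by (intro order.trans[OF abs_triangle_ineq] add_mono) (auto simp: abs_mult intro!: mult_left_le)
    then show "\<bar>(u *\<^sub>R x + v *\<^sub>R y) $ i\<bar> \<le> 1" using uv by simp
    show "(u *\<^sub>R x + v *\<^sub>R y) $ i = \<sigma>0 $ i" if "\<sigma>0 $ i \<noteq> 0"
      using x y uv that by (simp flip: distrib_right)
  qed
  moreover have "definite_sigs \<sigma>0 \<subseteq> ?S"
  proof
    fix \<sigma> assume "\<sigma> \<in> definite_sigs \<sigma>0"
    then have "\<sigma> $ i \<in> {- 1, 1}" "\<sigma>0 $ i \<noteq> 0 \<longrightarrow> \<sigma> $ i = \<sigma>0 $ i" for i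
      using definite_sigs_eq_cube_vertices[OF assms(2), of \<sigma>0]
      by (auto simp: definite_sigs_def cube_vertices_def)
    then show "\<sigma> \<in> ?S" by (smt (verit) insertE mem_Collect_eq singletonD)
  qed
  ultimately have "\<xi> \<in> ?S" using assms(1) by (meson hull_minimal subsetD)
  then show "\<bar>\<xi> $ i\<bar> \<le> 1" "\<sigma>0 $ i \<noteq> 0 \<Longrightarrow> \<xi> $ i = \<sigma>0 $ i" by auto
qed

lemma diag_mult_eq_abs_of_sign:
  assumes "\<And>i. sign_vec z $ i \<noteq> 0 \<Longrightarrow> \<xi> $ i = sign_vec z $ i"
  shows "diag \<xi> *v z = \<bar>z\<bar>"
proof (rule diag_mult_eq_abs)
  fix i show "\<bar>z $ i\<bar> = \<xi> $ i * z $ i"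
    using assms[of i] by (cases "z $ i = 0") (auto simp: sign_vec_def sgn_if split: if_splits)
qed

section \<open>Limiting gradients under LIKQ\<close>

context C1_switching_system
begin

text \<open>Replacing \<open>\<sigma>0\<close> by \<open>\<sigma>\<close> only adds \<open>L q\<close>, where \<open>q\<close> is the indicator vector of \<open>\<alpha>\<close>, to the
  right-hand side of the linearised switching equation, provided the solution equals \<open>\<sigma>\<close> on \<open>\<alpha>\<close>;
  LIKQ allows the direction \<open>v\<close> to be chosen accordingly.\<close>

lemma LIKQ_direction:
  assumes "LIKQ c x0"
    and z0: "z0 = switching_sol c x0" and \<sigma>: "\<sigma> \<in> definite_sigs (sign_vec z0)"
  obtains v where "\<And>i. z0 $ i = 0 \<Longrightarrow> slope \<sigma> (x0, \<bar>z0\<bar>, z0) v $ i = \<sigma> $ i"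
proof -
  define \<sigma>0 where "\<sigma>0 = sign_vec z0"
  define \<alpha> where "\<alpha> = {i. \<sigma>0 $ i = 0}"
  define Z L M where "Z = jac1 c (x0, \<bar>z0\<bar>, z0)" and "L = jac2 c (x0, \<bar>z0\<bar>, z0)"
    and "M = jac3 c (x0, \<bar>z0\<bar>, z0)"
  define B where "B = mat 1 - L ** diag \<sigma>0 - M"
  have tri: "strictly_lower_triangular L" "strictly_lower_triangular M"
    unfolding L_def M_def by (rule tri_jac2 tri_jac3)+
  have \<alpha>_iff: "i \<in> \<alpha> \<longleftrightarrow> z0 $ i = 0" for i by (simp add: \<alpha>_def \<sigma>0_def sign_vec_def sgn_zero_iff)
  have B: "B *v u = u - L *v (diag \<sigma>0 *v u) - M *v u" for u
    by (simp add: B_def matrix_vector_mult_diff_rdistrib matrix_vector_mul_assoc)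
  have "u = 0" if "B *v u = 0" for u
  proof -
    have "u = 0 + L *v (diag \<sigma>0 *v u) + M *v u" using that by (simp add: B algebra_simps)
    then have "u = tri_solve L M \<sigma>0 0" by (rule tri_solve_unique[OF tri])
    moreover have "0 = tri_solve L M \<sigma>0 0" by (rule tri_solve_unique[OF tri]) simp
    ultimately show "u = 0" by simp
  qed
  then have "invertible B" unfolding invertible_left_inverse matrix_left_invertible_ker by blast
  then have inv: "B ** matrix_inv B = mat 1"
    unfolding invertible_def matrix_inv_def by (rule someI2_ex) simp
  define q :: "real^'s::{finite,linorder}" where "q = (\<chi> i. if i \<in> \<alpha> then 1 else 0)"
  have "rank (row_selector \<alpha> ** (matrix_inv B ** Z)) = card \<alpha>"
    using assms(1) by (simp add: LIKQ_def Let_def B_def \<alpha>_def \<sigma>0_def Z_def L_def M_def z0 matrix_mul_assoc)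
  \<comment> \<open>The subtracted vector is what \<open>L q\<close> will contribute to
    \<open>u\<close>, so that \<open>u\<close> itself takes the values of \<open>\<sigma>\<close> on
    \<open>\<alpha>\<close>.\<close>
  then obtain v where v: "\<And>i. i \<in> \<alpha> \<Longrightarrow>
      ((matrix_inv B ** Z) *v v) $ i = (\<sigma> - matrix_inv B *v (L *v q)) $ i"
    by (rule row_selector_surj) blast
  define u where "u = matrix_inv B *v (Z *v v + L *v q)"
  have u_nth: "u $ i = \<sigma> $ i" if "i \<in> \<alpha>" for i
    using v[OF that] by (simp add: u_def matrix_vector_right_distrib matrix_vector_mul_assoc)
  have cube: "\<sigma> \<in> cube_vertices \<alpha> \<sigma>0"
    using \<sigma> definite_sigs_eq_cube_vertices[of \<sigma>0 z0 \<sigma>0] by (simp add: \<sigma>0_def \<alpha>_def)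
  have sq: "\<sigma> $ i * \<sigma> $ i = 1" if "i \<in> \<alpha>" for i
    using cube that by (auto simp: cube_vertices_def)
  \<comment> \<open>On \<open>\<alpha>\<close> the left side is
    \<open>\<sigma> $ i * \<sigma> $ i = 1\<close> and \<open>\<sigma>0\<close> vanishes; off
    \<open>\<alpha>\<close> the two signatures agree and \<open>q\<close> vanishes.\<close>
  have "diag \<sigma> *v u = diag \<sigma>0 *v u + q"
    using cube by (auto simp: vec_eq_iff q_def u_nth sq \<alpha>_def cube_vertices_def)
  moreover have "B *v u = Z *v v + L *v q"
    by (simp add: u_def matrix_vector_mul_assoc inv)
  ultimately have "u = Z *v v + L *v (diag \<sigma> *v u) + M *v u"
    by (simp add: B matrix_vector_right_distrib algebra_simps)
  then have "u = tri_solve L M \<sigma> (Z *v v)" by (rule tri_solve_unique[OF tri])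
  then have "slope \<sigma> (x0, \<bar>z0\<bar>, z0) v $ i = \<sigma> $ i" if "z0 $ i = 0" for i
    using u_nth[of i] that by (simp add: slope_def Z_def L_def M_def \<alpha>_iff)
  then show ?thesis by (rule that)
qed

lemma gradient_smooth_model_limiting:
  assumes \<phi>: "\<And>x. \<phi> x = f (x, \<bar>switching_sol c x\<bar>, switching_sol c x)"
    and "LIKQ c x0" and \<sigma>: "\<sigma> \<in> definite_sigs (sign_vec (switching_sol c x0))"
  shows "gradient (smooth_model f c x0 \<sigma>) x0 \<in> limiting_gradients \<phi> x0"
proof -
  define z0 \<zeta> where "z0 = switching_sol c x0" and "\<zeta> = model_sol c x0 \<sigma>"
  define p where "p x = (x, diag \<sigma> *v \<zeta> x, \<zeta> x)" for x
  have cube: "\<sigma> \<in> cube_vertices {i. sign_vec z0 $ i = 0} (sign_vec z0)"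
    using \<sigma> definite_sigs_eq_cube_vertices[of "sign_vec z0" z0 "sign_vec z0"] by (simp add: z0_def)
  then have \<sigma>_off: "\<sigma> $ i = sign_vec z0 $ i" if "sign_vec z0 $ i \<noteq> 0" for i
    using that by (auto simp: cube_vertices_def)
  have \<sigma>_sq: "\<sigma> $ i = 1 \<or> \<sigma> $ i = - 1" for i
    using \<sigma> by (auto simp: definite_sigs_def)
  have abs0: "diag \<sigma> *v z0 = \<bar>z0\<bar>" by (rule diag_mult_eq_abs_of_sign) (rule \<sigma>_off)
  obtain U where U: "open U" "x0 \<in> U" "continuous_on U \<zeta>"
      "\<And>x. x \<in> U \<Longrightarrow> \<zeta> x = c (x, diag \<sigma> *v \<zeta> x, \<zeta> x)"
    and x0: "\<zeta> x0 = z0"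
    using model_branch_model_sol[of \<sigma> x0] abs0 unfolding model_branch_def z0_def \<zeta>_def by blast
  have p0: "p x0 = (x0, \<bar>z0\<bar>, z0)" by (simp add: p_def x0 abs0)
  have tri0: "strictly_lower_triangular (jac2 c (p x0))" "strictly_lower_triangular (jac3 c (p x0))"
    unfolding p0 by (rule tri_jac2 tri_jac3)+
  obtain v where v: "\<And>i. z0 $ i = 0 \<Longrightarrow> slope \<sigma> (p x0) v $ i = \<sigma> $ i"
    unfolding p0 using LIKQ_direction[OF assms(2) z0_def \<sigma>[folded z0_def]] by blast
  have der\<zeta>: "(\<zeta> has_derivative slope \<sigma> (p x0)) (at x0)"
    by (rule branch_has_derivative(1)[OF U p_def tri0])

  \<comment> \<open>The open orthant of \<open>\<sigma>\<close>. On \<open>V\<close> the branch has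
    strict signs \<open>\<sigma>\<close>, hence solves the original switching equation, and
    \<open>\<phi>\<close> is smooth there.\<close>
  define P where "P = {y :: real^'s::{finite,linorder}. \<forall>i. 0 < \<sigma> $ i * y $ i}"
  have "open (\<Inter>i. {y :: real^'s::{finite,linorder}. 0 < \<sigma> $ i * y $ i})"
    by (intro open_INT ballI open_Collect_less continuous_intros) simp
  then have "open P" by (simp add: P_def Collect_all_eq)
  define V where "V = U \<inter> \<zeta> -` P"
  have "open V"
    using U(1,3) \<open>open P\<close> unfolding V_def by (simp add: continuous_on_open_vimage Int_commute)
  have V: "diag \<sigma> *v \<zeta> x = \<bar>\<zeta> x\<bar>" "\<zeta> x = switching_sol c x" if "x \<in> V" for x
  proof -
    have pos: "0 < \<sigma> $ i * \<zeta> x $ i" for i using that by (simp add: V_def P_def)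
    have "\<bar>\<zeta> x $ i\<bar> = \<sigma> $ i * \<zeta> x $ i" for i
      using pos[of i] \<sigma>_sq[of i] by (elim disjE) simp_all
    then show "diag \<sigma> *v \<zeta> x = \<bar>\<zeta> x\<bar>" by (rule diag_mult_eq_abs)
    with U(4)[of x] that show "\<zeta> x = switching_sol c x"
      unfolding switching_sol_iff by (simp add: V_def)
  qed
  have tri: "strictly_lower_triangular (jac2 c (p x))" "strictly_lower_triangular (jac3 c (p x))"
    if "x \<in> V" for x
    unfolding p_def V(1)[OF that] by (rule tri_jac2 tri_jac3)+
  have der\<phi>: "(\<phi> has_derivative (\<lambda>w. f' (p x) (tangent \<sigma> (p x) w))) (at x)" if "x \<in> V" for x
  proof -
    have "(p has_derivative tangent \<sigma> (p x)) (at x)"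
      unfolding p_def[abs_def]
      by (rule branch_has_derivative(2)[OF U(1) _ U(3,4) refl])
        (use that tri in \<open>simp_all add: V_def flip: p_def\<close>)
    then have "((\<lambda>x. f (p x)) has_derivative (\<lambda>w. f' (p x) (tangent \<sigma> (p x) w))) (at x)"
      by (rule has_derivative_compose[OF _ der_f])
    then show ?thesis
      by (rule has_derivative_transform_within_open[OF _ \<open>open V\<close> that]) (simp add: \<phi> p_def V(1) flip: V(2))
  qed

  define h where "h k = inverse (real (Suc k))" for k
  have h: "h \<longlonglongrightarrow> 0" and h_pos: "0 < h k" for k
    using LIMSEQ_inverse_real_of_nat by (simp_all add: h_def[abs_def])
  define X where "X k = x0 + h k *\<^sub>R v" for k
  have X: "X \<longlonglongrightarrow> x0"
    unfolding X_def[abs_def] using tendsto_add[OF tendsto_const tendsto_scaleR[OF h tendsto_const]] by simp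
  have cont0: "isCont \<zeta> x0" using der\<zeta> has_derivative_continuous by blast
  have \<zeta>X: "(\<lambda>k. \<zeta> (X k)) \<longlonglongrightarrow> z0"
    using isCont_tendsto_compose[OF cont0 X] by (simp add: x0)
  \<comment> \<open>Components that do not vanish at \<open>x0\<close> keep their sign by
    continuity. A vanishing one has slope \<open>\<sigma> $ i\<close> along \<open>v\<close>, so its
    quotient by \<open>h k\<close>, multiplied by \<open>\<sigma> $ i\<close>, tends to
    \<open>1\<close>.\<close>
  have pos: "\<forall>\<^sub>F k in sequentially. 0 < \<sigma> $ i * \<zeta> (X k) $ i" for i
  proof (cases "z0 $ i = 0")
    case False
    then have "0 < \<sigma> $ i * z0 $ i"
      using \<sigma>_off[of i] by (auto simp: sign_vec_def sgn_if split: if_splits)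
    moreover have "(\<lambda>k. \<sigma> $ i * \<zeta> (X k) $ i) \<longlonglongrightarrow> \<sigma> $ i * z0 $ i"
      by (intro tendsto_mult tendsto_const tendsto_vec_nth \<zeta>X)
    ultimately show ?thesis by (rule order_tendstoD(1)[rotated])
  next
    case True
    have "((\<lambda>t. \<zeta> (x0 + t *\<^sub>R v)) has_derivative (\<lambda>t. slope \<sigma> (p x0) (t *\<^sub>R v))) (at 0)"
      by (rule has_derivative_compose[where g = \<zeta>]) (auto intro!: derivative_eq_intros simp: der\<zeta>)
    then have "((\<lambda>t. \<zeta> (x0 + t *\<^sub>R v)) has_vector_derivative slope \<sigma> (p x0) v) (at 0)"
      unfolding has_vector_derivative_def
      by (simp add: linear_cmul[OF has_derivative_linear[OF der\<zeta>]])
    then have "((\<lambda>t. \<zeta> (x0 + t *\<^sub>R v) $ i) has_vector_derivative slope \<sigma> (p x0) v $ i) (at 0)"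
      by (rule bounded_linear.has_vector_derivative[OF bounded_linear_vec_nth])
    then have "((\<lambda>t. \<zeta> (x0 + t *\<^sub>R v) $ i / t) \<longlongrightarrow> \<sigma> $ i) (at 0)"
      by (simp add: has_real_derivative_iff_has_vector_derivative[symmetric] DERIV_def x0 True v)
    moreover have "filterlim h (at 0) sequentially"
      using h h_pos unfolding filterlim_at by (auto simp: less_imp_neq[THEN not_sym])
    ultimately have "(\<lambda>k. \<zeta> (X k) $ i / h k) \<longlonglongrightarrow> \<sigma> $ i"
      unfolding X_def by (rule filterlim_compose)
    then have "(\<lambda>k. \<sigma> $ i * (\<zeta> (X k) $ i / h k)) \<longlonglongrightarrow> \<sigma> $ i * \<sigma> $ i"
      by (intro tendsto_mult tendsto_const)
    moreover have "0 < \<sigma> $ i * \<sigma> $ i" using \<sigma>_sq[of i] by auto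
    ultimately have "\<forall>\<^sub>F k in sequentially. 0 < \<sigma> $ i * (\<zeta> (X k) $ i / h k)"
      by (rule order_tendstoD(1))
    then show ?thesis
      by eventually_elim (simp add: pos_less_divide_eq[OF h_pos])
  qed
  have "\<forall>\<^sub>F k in sequentially. X k \<in> V"
    using topological_tendstoD[OF X U(1,2)] eventually_all_finite[OF pos]
    by eventually_elim (simp add: V_def P_def)
  then obtain N where N: "\<And>k. k \<ge> N \<Longrightarrow> X k \<in> V" unfolding eventually_sequentially by blast
  \<comment> \<open>The definition of limiting gradients asks for differentiability at every term,
    so the initial terms outside \<open>V\<close> are dropped.\<close>
  define Y where "Y k = X (k + N)" for k
  have Y: "Y k \<in> V" for k by (simp add: Y_def N)
  have Y_lim: "Y \<longlonglongrightarrow> x0" unfolding Y_def[abs_def] by (rule LIMSEQ_ignore_initial_segment[OF X])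
  have "(\<lambda>k. \<zeta> (Y k)) \<longlonglongrightarrow> \<zeta> x0" by (rule isCont_tendsto_compose[OF cont0 Y_lim])
  then have pY: "(\<lambda>k. p (Y k)) \<longlonglongrightarrow> p x0"
    unfolding p_def
    by (intro tendsto_Pair Y_lim bounded_linear.tendsto[OF matrix_vector_mul_bounded_linear])
  have lim: "(\<lambda>k. gradient \<phi> (Y k) \<bullet> w) \<longlonglongrightarrow> gradient (smooth_model f c x0 \<sigma>) x0 \<bullet> w" for w
  proof -
    have "gradient (smooth_model f c x0 \<sigma>) x0 \<bullet> w = f' (p x0) (tangent \<sigma> (p x0) w)"
      using inner_gradient_smooth_model[of \<sigma> x0 "p x0" w] abs0 p0 by (simp add: z0_def)
    moreover have "gradient \<phi> (Y k) \<bullet> w = f' (p (Y k)) (tangent \<sigma> (p (Y k)) w)" for k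
      by (rule has_derivative_gradient[OF der\<phi>[OF Y]])
    moreover have "(\<lambda>k. f' (p (Y k))) \<longlonglongrightarrow> f' (p x0)"
      by (rule continuous_on_tendsto_compose[OF cont_f' pY]) auto
    moreover have "(\<lambda>k. tangent \<sigma> (p (Y k)) w) \<longlonglongrightarrow> tangent \<sigma> (p x0) w"
      by (rule tangent_tendsto[OF pY tri[OF Y] tri0])
    ultimately show ?thesis by (simp add: blinfun.tendsto)
  qed
  have "(\<lambda>k. gradient \<phi> (Y k)) \<longlonglongrightarrow> gradient (smooth_model f c x0 \<sigma>) x0"
    using lim[of "axis _ 1"] by (intro vec_tendstoI) (simp add: inner_axis)
  then show ?thesis
    unfolding limiting_gradients_def using Y_lim der\<phi>[OF Y] differentiable_def by blast
qed

end

section \<open>The gradient identity and the Clarke inclusion\<close>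

lemma evaluation_procedure_imp_C1_switching_system:
  fixes f :: "(real^'n) \<times> (real^'s::{finite,linorder}) \<times> (real^'s::{finite,linorder}) \<Rightarrow> real"
  assumes "evaluation_procedure f c \<phi>"
  obtains f' c' where "C1_switching_system f c f' c'"
proof -
  have cont: "continuous_on UNIV g'"
    if "\<And>x. (g' has_derivative blinfun_apply (g'' x)) (at x)"
    for g' :: "'a::euclidean_space \<Rightarrow> 'b::real_normed_vector" and g''
    by (simp add: continuous_at_imp_continuous_on has_derivative_continuous[OF that])
  have "C2 f" "C2 c" and tri: "\<And>x z. strictly_lower_triangular (jac2 c (x, \<bar>z\<bar>, z))"
      "\<And>x z. strictly_lower_triangular (jac3 c (x, \<bar>z\<bar>, z))"
    using assms by (simp_all add: evaluation_procedure_def)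
  obtain f' f'' where f: "\<And>x. (f has_derivative blinfun_apply (f' x)) (at x)"
      "\<And>x. (f' has_derivative blinfun_apply (f'' x)) (at x)"
    using \<open>C2 f\<close> unfolding C2_def by blast
  obtain c' c'' where c: "\<And>x. (c has_derivative blinfun_apply (c' x)) (at x)"
      "\<And>x. (c' has_derivative blinfun_apply (c'' x)) (at x)"
    using \<open>C2 c\<close> unfolding C2_def by blast
  have "C1_switching_system f c f' c'"
    by (rule C1_switching_system.intro[OF f(1) c(1) cont[OF f(2)] cont[OF c(2)] tri])
  then show ?thesis by (rule that)
qed

theorem theorem9:
  fixes \<phi> :: "real^'n \<Rightarrow> real"
    and f :: "(real^'n) \<times> (real^'s::{finite,linorder}) \<times> (real^'s::{finite,linorder}) \<Rightarrow> real"
    and c :: "(real^'n) \<times> (real^'s::{finite,linorder}) \<times> (real^'s::{finite,linorder}) \<Rightarrow> real^'s::{finite,linorder}"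
    and x0 :: "real^'n" and \<sigma>0 \<xi> :: "real^'s::{finite,linorder}" and \<alpha> :: "('s::{finite,linorder}) set"
    and \<beta> :: "real^'s::{finite,linorder} \<Rightarrow> real^'s::{finite,linorder} \<Rightarrow> real"
  assumes "evaluation_procedure f c \<phi>"
    and "\<sigma>0 = sign_vec (switching_sol c x0)"
    and "\<alpha> = {i. \<sigma>0 $ i = 0}"
    and "\<beta> = (\<lambda>\<sigma> \<xi>. \<Prod>i\<in>\<alpha>. (\<sigma> $ i * \<xi> $ i + 1) / 2)"
    and "\<xi> \<in> convex hull (definite_sigs \<sigma>0)"
  shows "(\<Sum>\<sigma>\<in>definite_sigs \<sigma>0. \<beta> \<sigma> \<xi> *\<^sub>R gradient (smooth_model f c x0 \<sigma>) x0) =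
           gradient (smooth_model f c x0 \<xi>) x0 \<and>
         (\<forall>\<sigma>\<in>definite_sigs \<sigma>0. \<beta> \<sigma> \<xi> \<ge> 0) \<and>
         (\<Sum>\<sigma>\<in>definite_sigs \<sigma>0. \<beta> \<sigma> \<xi>) = 1 \<and>
         (LIKQ c x0 \<longrightarrow> gradient (smooth_model f c x0 \<xi>) x0 \<in> clarke_gradients \<phi> x0)"
proof -
  obtain f' c' where "C1_switching_system f c f' c'"
    using assms(1) by (rule evaluation_procedure_imp_C1_switching_system)
  then interpret C1_switching_system f c f' c' .
  let ?D = "definite_sigs \<sigma>0"
  let ?g = "\<lambda>\<xi>. gradient (smooth_model f c x0 \<xi>) x0"
  define z0 where "z0 = switching_sol c x0"
  define p where "p = (x0, \<bar>z0\<bar>, z0)"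
  note \<sigma>0 = assms(2)[folded z0_def]
  \<comment> \<open>Stated on the whole hull so that it serves \<open>\<xi>\<close> and every vertex
    \<open>\<sigma>\<close> alike.\<close>
  have g: "?g \<eta> \<bullet> v = f' p (tangent \<eta> p v)" if "\<eta> \<in> convex hull ?D" for \<eta> v
  proof (rule inner_gradient_smooth_model[of \<eta> x0 p v, folded z0_def])
    show "diag \<eta> *v z0 = \<bar>z0\<bar>"
      by (rule diag_mult_eq_abs_of_sign) (use convex_hull_definite_sigs_bounds(2)[OF that \<sigma>0] \<sigma>0 in auto)
  qed (simp add: p_def)
  have D: "?D = cube_vertices \<alpha> \<xi>"
    using definite_sigs_eq_cube_vertices[OF \<sigma>0 convex_hull_definite_sigs_bounds(2)[OF assms(5) \<sigma>0]]
    by (simp add: assms(3))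
  have tri: "strictly_lower_triangular (jac2 c p)" "strictly_lower_triangular (jac3 c p)"
    unfolding p_def by (rule tri_jac2 tri_jac3)+

  have sum_g: "(\<Sum>\<sigma>\<in>?D. \<beta> \<sigma> \<xi> *\<^sub>R ?g \<sigma>) = ?g \<xi>"
  \<comment> \<open>Pairing with a vector \<open>v\<close> reduces the claim to interpolating
    \<open>tangent\<close> in \<open>\<xi>\<close> and applying the linear map
    \<open>f' p\<close>.\<close>
  proof (rule vector_eq_rdot[THEN iffD1], rule)
    fix v
    have "?g \<xi> \<bullet> v = f' p (tangent \<xi> p v)" by (rule g[OF assms(5)])
    also have "tangent \<xi> p v = (\<Sum>\<sigma>\<in>?D. \<beta> \<sigma> \<xi> *\<^sub>R tangent \<sigma> p v)"
      unfolding D assms(4)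
      by (rule multiaffine_interpolation[where g = "\<lambda>\<xi>. tangent \<xi> p v"]) (simp, rule tangent_affine_coord[OF tri])
    also have "f' p \<dots> = (\<Sum>\<sigma>\<in>?D. \<beta> \<sigma> \<xi> * f' p (tangent \<sigma> p v))"
      by (simp add: blinfun.sum_right blinfun.scaleR_right)
    also have "\<dots> = (\<Sum>\<sigma>\<in>?D. \<beta> \<sigma> \<xi> * (?g \<sigma> \<bullet> v))"
      by (rule sum.cong) (simp_all add: g hull_inc)
    finally show "(\<Sum>\<sigma>\<in>?D. \<beta> \<sigma> \<xi> *\<^sub>R ?g \<sigma>) \<bullet> v = ?g \<xi> \<bullet> v" by (simp add: inner_sum_left)
  qed
  have nonneg: "\<beta> \<sigma> \<xi> \<ge> 0" if "\<sigma> \<in> ?D" for \<sigma>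
    unfolding assms(4)
  proof (rule prod_nonneg)
    fix i
    have "\<bar>\<xi> $ i\<bar> \<le> 1" using convex_hull_definite_sigs_bounds(1)[OF assms(5) \<sigma>0] .
    moreover have "\<sigma> $ i \<in> {- 1, 1}" using that by (simp add: definite_sigs_def)
    ultimately show "0 \<le> (\<sigma> $ i * \<xi> $ i + 1) / 2" by auto
  qed
  have sum_1: "(\<Sum>\<sigma>\<in>?D. \<beta> \<sigma> \<xi>) = 1"
  proof -
    \<comment> \<open>The weights sum to one because interpolation reproduces the constant function
      \<open>1\<close>.\<close>
    have "1 = (\<Sum>\<sigma>\<in>?D. \<beta> \<sigma> \<xi> *\<^sub>R (1::real))"
      unfolding D assms(4)
      by (rule multiaffine_interpolation[where g = "\<lambda>_. 1"]) (simp_all add: field_simps)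
    then show ?thesis by simp
  qed
  have "?g \<xi> \<in> clarke_gradients \<phi> x0" if "LIKQ c x0"
  proof -
    have \<phi>: "\<And>x. \<phi> x = f (x, \<bar>switching_sol c x\<bar>, switching_sol c x)"
      using assms(1) by (simp add: evaluation_procedure_def)
    have "?g \<sigma> \<in> clarke_gradients \<phi> x0" if "\<sigma> \<in> ?D" for \<sigma>
      unfolding clarke_gradients_def
      by (rule hull_inc, rule gradient_smooth_model_limiting[OF \<phi> \<open>LIKQ c x0\<close>])
        (use that in \<open>simp add: assms(2)\<close>)
    moreover have "finite ?D" by (simp add: D finite_cube_vertices)
    ultimately have "(\<Sum>\<sigma>\<in>?D. \<beta> \<sigma> \<xi> *\<^sub>R ?g \<sigma>) \<in> clarke_gradients \<phi> x0"
      using nonneg sum_1 unfolding clarke_gradients_def by (intro convex_sum convex_convex_hull)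
    then show ?thesis by (simp only: sum_g)
  qed
  with sum_g nonneg sum_1 show ?thesis by blast
qed

end
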